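(* Let $T>0$, $\sigma>0$, and consider the Cauchy problem $$\begin{cases}\partial_t m-\sigma\Delta_{\mathcal H}m+b\cdot D_{\mathcal H}m+c\,m=0&\text{in }\mathbb H^1\times(0,T),\\ m(x,0)=m_0(x)&\text{on }\mathbb H^1.\end{cases}$$ Assume that $b:\mathbb H^1\times[0,T]\to\mathbb R^2$ and $c:\mathbb H^1\times[0,T]\to\mathbb R$ are bounded continuous functions and that $b$ has a continuous and bounded horizontal gradient. For $i=1,2$, let $m_i\in C^2_{\mathcal H}(\mathbb H^1\times(0,T])\cap C^0(\mathbb H^1\times[0,T])$ be two classical solutions of this problem such that, for some positive constant $\alpha$, $$\iint_{\mathbb H^1\times[0,T]}|m_i(x,t)|\exp\{-\alpha(\|x\|_{\mathcal H}^2+1)\}\,dx\,dt<\infty .$$ Then $m_1=m_2$.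
   Context: $\mathbb H^1$ is $\mathbb R^3$ (Heisenberg group) with vector fields $X_1=\partial_{x_1}-x_2\partial_{x_3}$, $X_2=\partial_{x_2}+x_1\partial_{x_3}$. $D_{\mathcal H}m=(X_1m,X_2m)$, $\Delta_{\mathcal H}m=X_1^2m+X_2^2m$. The horizontal gradient of $b=(b_1,b_2)$ is the collection of $X_ib_j$, $i,j\in\{1,2\}$. $\|x\|_{\mathcal H}=((x_1^2+x_2^2)^2+x_3^2)^{1/4}$. $C^2_{\mathcal H}$ is the parabolic space adapted to $X_1,X_2$: functions that are continuous together with $\partial_tm$, $X_im$ and $X_iX_jm$, $i,j\in\{1,2\}$. *)

theory Defs
  imports "HOL-Analysis.Analysis"
begin

text \<open>The Heisenberg group is \<open>real^3\<close>. Indices range over the types \<open>2\<close> and \<open>3\<close>, in which the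
  numeral \<open>2 :: 2\<close> (resp. \<open>3 :: 3\<close>) is the residue \<open>0\<close>, so that \<open>i :: 2\<close> is \<open>1\<close> or \<open>2\<close>.
  Vector fields are written in the coordinate frame: \<open>axis k 1\<close> stands for the partial
  derivative in the \<open>k\<close>-th variable.\<close>

definition hfield :: "2 \<Rightarrow> real^3 \<Rightarrow> real^3" where
  "hfield i x = (if i = 1 then axis 1 1 - (x $ 2) *\<^sub>R axis 3 1
                          else axis 2 1 + (x $ 1) *\<^sub>R axis 3 1)"

text \<open>\<open>X\<^sub>i f\<close> is the derivative of \<open>f\<close> along the integral curves of \<open>hfield i\<close>, which are the straight
  lines \<open>s \<mapsto> x + s *\<^sub>R hfield i x\<close> (lemma \<open>hfield_flow\<close>). Functions in the parabolic spaces
  need not have Euclidean partial derivatives; when \<open>f\<close> is differentiable, \<open>X\<^sub>i f\<close> is the usual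
  combination of them (lemma \<open>hderiv_eq\<close>).\<close>

definition hdifferentiable :: "2 \<Rightarrow> (real^3 \<Rightarrow> real) \<Rightarrow> real^3 \<Rightarrow> bool" where
  "hdifferentiable i f x \<longleftrightarrow> (\<lambda>s::real. f (x + s *\<^sub>R hfield i x)) differentiable (at 0)"

definition hderiv :: "2 \<Rightarrow> (real^3 \<Rightarrow> real) \<Rightarrow> real^3 \<Rightarrow> real" where
  "hderiv i f x = deriv (\<lambda>s::real. f (x + s *\<^sub>R hfield i x)) 0"

lemma hfield_flow:
  "((\<lambda>s. x + s *\<^sub>R hfield i x) has_vector_derivative hfield i (x + s *\<^sub>R hfield i x)) (at s)"
proof -
  have "hfield i (x + s *\<^sub>R hfield i x) = hfield i x"
    by (simp add: hfield_def axis_def)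
  moreover have "((\<lambda>s. x + s *\<^sub>R hfield i x) has_vector_derivative hfield i x) (at s)"
    by (auto intro!: derivative_eq_intros)
  ultimately show ?thesis by simp
qed

lemma hderiv_eq:
  assumes "(f has_derivative f') (at x)"
  shows "hdifferentiable i f x"
    and "hderiv 1 f x = f' (axis 1 1) - x $ 2 * f' (axis 3 1)"
    and "hderiv 2 f x = f' (axis 2 1) + x $ 1 * f' (axis 3 1)"
proof -
  have lin: "linear f'"
    using assms by (rule has_derivative_linear)
  have D: "((\<lambda>s. f (x + s *\<^sub>R hfield i x)) has_real_derivative f' (hfield i x)) (at 0)" for i
  proof -
    have "((\<lambda>s::real. x + s *\<^sub>R hfield i x) has_derivative (\<lambda>s. s *\<^sub>R hfield i x)) (at 0)"
      by (auto intro!: derivative_eq_intros)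
    moreover have "(f has_derivative f') (at (x + (0::real) *\<^sub>R hfield i x))"
      using assms by simp
    ultimately have "((\<lambda>s. f (x + s *\<^sub>R hfield i x)) has_derivative (\<lambda>s. f' (s *\<^sub>R hfield i x))) (at 0)"
      by (rule has_derivative_compose)
    then show ?thesis
      by (simp add: has_field_derivative_def linear_cmul[OF lin] mult.commute[of _ "f' _"])
  qed
  show "hdifferentiable i f x"
    using D unfolding hdifferentiable_def real_differentiable_def by blast
  have "hderiv i f x = f' (hfield i x)" for i
    unfolding hderiv_def by (rule DERIV_imp_deriv[OF D])
  then show "hderiv 1 f x = f' (axis 1 1) - x $ 2 * f' (axis 3 1)"
    and "hderiv 2 f x = f' (axis 2 1) + x $ 1 * f' (axis 3 1)"
    by (simp_all add: hfield_def linear_diff[OF lin] linear_add[OF lin] linear_cmul[OF lin])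
qed

definition hgrad :: "(real^3 \<Rightarrow> real) \<Rightarrow> real^3 \<Rightarrow> real^2" where
  "hgrad f x = (\<chi> i. hderiv i f x)"

definition hlaplacian :: "(real^3 \<Rightarrow> real) \<Rightarrow> real^3 \<Rightarrow> real" where
  "hlaplacian f x = (\<Sum>i\<in>UNIV. hderiv i (hderiv i f) x)"

definition hnorm :: "real^3 \<Rightarrow> real" where
  "hnorm x = root 4 (((x $ 1)\<^sup>2 + (x $ 2)\<^sup>2)\<^sup>2 + (x $ 3)\<^sup>2)"

text \<open>The space \<open>C\<^sup>2\<^sub>H\<close> on the cylinder over the time interval \<open>J\<close>; the time derivative is
  taken within \<open>J\<close>, hence one-sided at an endpoint belonging to \<open>J\<close>.\<close>

definition C2H :: "real set \<Rightarrow> (real^3 \<Rightarrow> real \<Rightarrow> real) \<Rightarrow> bool" where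
  "C2H J m \<longleftrightarrow>
     continuous_on (UNIV \<times> J) (\<lambda>(x, t). m x t) \<and>
     (\<forall>x. \<forall>t\<in>J. m x differentiable (at t within J)) \<and>
     continuous_on (UNIV \<times> J) (\<lambda>(x, t). vector_derivative (m x) (at t within J)) \<and>
     (\<forall>i. (\<forall>x. \<forall>t\<in>J. hdifferentiable i (\<lambda>y. m y t) x) \<and>
          continuous_on (UNIV \<times> J) (\<lambda>(x, t). hderiv i (\<lambda>y. m y t) x)) \<and>
     (\<forall>i j. (\<forall>x. \<forall>t\<in>J. hdifferentiable i (hderiv j (\<lambda>y. m y t)) x) \<and>
            continuous_on (UNIV \<times> J) (\<lambda>(x, t). hderiv i (hderiv j (\<lambda>y. m y t)) x))"

definition classical_solution ::
  "real \<Rightarrow> real \<Rightarrow> (real^3 \<Rightarrow> real \<Rightarrow> real^2) \<Rightarrow> (real^3 \<Rightarrow> real \<Rightarrow> real) \<Rightarrow> (real^3 \<Rightarrow> real)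
     \<Rightarrow> (real^3 \<Rightarrow> real \<Rightarrow> real) \<Rightarrow> bool" where
  "classical_solution T \<sigma> b c m\<^sub>0 m \<longleftrightarrow>
     C2H {0<..T} m \<and>
     continuous_on (UNIV \<times> {0..T}) (\<lambda>(x, t). m x t) \<and>
     (\<forall>x. \<forall>t\<in>{0<..<T}.
        deriv (m x) t - \<sigma> * hlaplacian (\<lambda>y. m y t) x
          + b x t \<bullet> hgrad (\<lambda>y. m y t) x + c x t * m x t = 0) \<and>
     (\<forall>x. m x 0 = m\<^sub>0 x)"

end

(* The difference m of the two solutions satisfies a weighted L1 estimate. With S(m) = sqrt(1 + m^2) - 1,
   a convex smoothing of |m|, and g = sqrt(1 + (x1^2 + x2^2)^2 + x3^2), a smooth function dominating
   the squared homogeneous norm, one has |D_H g|^2 <= 4 g and |Delta_H g| <= 13. Hence for a time step whose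
   length depends only on the data, exp(- beta(t) g) is a supersolution of the adjoint equation when
   beta grows linearly from 2 alpha to 3 alpha. Multiplying it by the C^2 cutoff max(0, 1 - g/R)^3
   costs an error (C/R) exp(- alpha g), so the energy, the integral of S(m) against this weight, is at
   most C/R times the finite integral of |m| exp(- alpha g). As R tends to infinity, m vanishes on
   the time step, and finitely many steps exhaust [0, T].

   The integral of X_i F vanishes for compactly supported F that are differentiable along X_i only:
   the flow of X_i consists of volume preserving shears, so the integral of F composed with the flow is
   constant in the flow parameter. *)
theory Submission
  imports Defs
begin

section \<open>Derivatives along the horizontal fields\<close>

text \<open>Existence and value of the derivative in one relation, so that the one-variable rules
  for differences, products and compositions apply directly.\<close>

definition has_hderiv :: "2 \<Rightarrow> (real^3 \<Rightarrow> real) \<Rightarrow> real \<Rightarrow> real^3 \<Rightarrow> bool" where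
  "has_hderiv i f D x \<longleftrightarrow> ((\<lambda>s. f (x + s *\<^sub>R hfield i x)) has_real_derivative D) (at 0)"

lemma has_hderiv_diff:
  "has_hderiv i f D x \<Longrightarrow> has_hderiv i g E x \<Longrightarrow> has_hderiv i (\<lambda>x. f x - g x) (D - E) x"
  unfolding has_hderiv_def by (rule DERIV_diff)

lemma has_hderiv_mult:
  "has_hderiv i f D x \<Longrightarrow> has_hderiv i g E x \<Longrightarrow>
    has_hderiv i (\<lambda>x. f x * g x) (D * g x + E * f x) x"
  unfolding has_hderiv_def by (drule (1) DERIV_mult) simp

lemma has_hderiv_cmult: "has_hderiv i f D x \<Longrightarrow> has_hderiv i (\<lambda>x. k * f x) (k * D) x"
  unfolding has_hderiv_def by (rule DERIV_cmult)

lemma has_hderiv_compose: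
  "(F has_real_derivative D') (at (f x)) \<Longrightarrow> has_hderiv i f D x \<Longrightarrow>
    has_hderiv i (\<lambda>x. F (f x)) (D' * D) x"
  unfolding has_hderiv_def by (rule DERIV_chain2) simp_all

lemma has_hderiv_hderiv: "hdifferentiable i f x \<Longrightarrow> has_hderiv i f (hderiv i f x) x"
  unfolding has_hderiv_def hderiv_def hdifferentiable_def
  using DERIV_deriv_iff_real_differentiable by blast

text \<open>The coefficients of X_1 depend only on x_2, which the flow of X_1 leaves fixed, and
  those of X_2 only on x_1, which the flow of X_2 leaves fixed. Hence each field is constant along
  its own lines.\<close>

lemma hfield_line: "hfield i (x + s *\<^sub>R hfield i x) = hfield i x"
  by (simp add: hfield_def axis_def)

text \<open>The field is constant along the line, so moving the base point along it only shifts the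
  parameter, and a derivative at 0 becomes one at \<open>s\<close>.\<close>

lemma has_hderiv_along_line:
  assumes "\<And>x. has_hderiv i f (f' x) x"
  shows "((\<lambda>s. f (x + s *\<^sub>R hfield i x)) has_real_derivative f' (x + s *\<^sub>R hfield i x)) (at s)"
proof -
  have "((\<lambda>r. f ((x + s *\<^sub>R hfield i x) + r *\<^sub>R hfield i x)) has_real_derivative
      f' (x + s *\<^sub>R hfield i x)) (at 0)"
    using assms[of "x + s *\<^sub>R hfield i x"] unfolding has_hderiv_def hfield_line .
  then have "((\<lambda>r. f (x + (r + s) *\<^sub>R hfield i x)) has_real_derivative
      f' (x + s *\<^sub>R hfield i x)) (at 0)"
    by (simp add: algebra_simps)
  then show ?thesis
    using DERIV_shift[of "\<lambda>s. f (x + s *\<^sub>R hfield i x)" "f' (x + s *\<^sub>R hfield i x)" 0 s] by simp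
qed

section \<open>Integration by parts\<close>

text \<open>The linear part of the flow of X_i at time \<open>s\<close>: since
  \<open>hfield i\<close> is affine, the flow is this shear followed by a translation.\<close>

definition shear :: "2 \<Rightarrow> real \<Rightarrow> real^3 \<Rightarrow> real^3" where
  "shear i s x = x + s *\<^sub>R (hfield i x - hfield i 0)"

lemma linear_shear: "linear (shear i s)"
  by (rule linearI) (auto simp: shear_def hfield_def algebra_simps)

lemma det_shear: "det (matrix (shear i s)) = 1"
  unfolding det_3 by (simp add: matrix_def shear_def hfield_def axis_def)

lemma integral_flow:
  assumes cont: "continuous_on UNIV F" and supp: "\<And>x. x \<notin> cbox a b \<Longrightarrow> F x = (0::real)"
  shows "integral UNIV (\<lambda>x. F (x + s *\<^sub>R hfield i x)) = integral UNIV F"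
proof -
  define \<phi> where "\<phi> x = x + s *\<^sub>R hfield i x" for x
  have der: "(\<phi> has_derivative shear i s) (at x)" for x
  proof -
    have "\<phi> = (\<lambda>x. shear i s x + s *\<^sub>R hfield i 0)"
      by (auto simp: \<phi>_def shear_def algebra_simps)
    then show ?thesis
      using linear_imp_has_derivative[OF linear_shear] by (auto intro!: derivative_eq_intros)
  qed
  \<comment> \<open>The flow at time \<open>-r\<close> inverts the flow at time \<open>r\<close>,
    because the field takes the same value at both ends of the segment.\<close>
  have inv: "x + r *\<^sub>R hfield i x + (- r) *\<^sub>R hfield i (x + r *\<^sub>R hfield i x) = x" for r x
    unfolding hfield_line by simp
  have "inj \<phi>"
    unfolding \<phi>_def by (rule inj_on_inverseI) (rule inv)
  have "surj \<phi>"
    unfolding \<phi>_def using inv[of _ "- s"] by (intro surjI[of _ "\<lambda>x. x + (- s) *\<^sub>R hfield i x"]) simp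
  have bl: "bounded_linear (\<lambda>r. r *\<^sub>R (1 :: real^1))"
    by (rule bounded_linear_scaleR_left)
  \<comment> \<open>The change of variables theorem applied below concerns integrands with values in
    a space of vectors, so \<open>F\<close> is carried through \<open>real^1\<close> and recovered
    as the first component.\<close>
  define G :: "real^3 \<Rightarrow> real^1" where "G x = F x *\<^sub>R 1" for x
  have "F absolutely_integrable_on UNIV"
  proof -
    have "F absolutely_integrable_on cbox a b"
      using cont by (intro absolutely_integrable_continuous) (auto intro: continuous_on_subset)
    then have "(\<lambda>x. if x \<in> cbox a b then F x else 0) absolutely_integrable_on UNIV"
      using absolutely_integrable_restrict_UNIV by blast
    also have "(\<lambda>x. if x \<in> cbox a b then F x else 0) = F"
      using supp by auto
    finally show ?thesis .
  qed
  then have G: "G absolutely_integrable_on UNIV"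
    using absolutely_integrable_linear[OF _ bl] by (simp add: G_def[abs_def] o_def)
  have *: "(\<lambda>x. G (\<phi> x)) absolutely_integrable_on UNIV \<and>
      integral UNIV (\<lambda>x. G (\<phi> x)) = integral UNIV G"
    using has_absolute_integral_change_of_variables[of UNIV \<phi> "\<lambda>x. shear i s" G "integral UNIV G"]
      der G \<open>inj \<phi>\<close> \<open>surj \<phi>\<close> by (simp add: det_shear)
  have nth: "bounded_linear (\<lambda>v::real^1. v $ 1)"
    by (rule bounded_linear_vec_nth)
  have "integral UNIV (\<lambda>x. F (\<phi> x)) = integral UNIV (\<lambda>x. G (\<phi> x)) $ 1"
    using integral_linear[OF set_lebesgue_integral_eq_integral(1)[OF *[THEN conjunct1]] nth]
    by (simp add: G_def o_def)
  also have "\<dots> = integral UNIV G $ 1"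
    using * by simp
  also have "\<dots> = integral UNIV F"
    using integral_linear[OF set_lebesgue_integral_eq_integral(1)[OF G] nth]
    by (simp add: G_def o_def)
  finally show ?thesis
    unfolding \<phi>_def .
qed

lemma continuous_on_hfield:
  "continuous_on S f \<Longrightarrow> continuous_on S (\<lambda>x. hfield i (f x))"
  unfolding hfield_def by (cases "i = 1") (auto intro!: continuous_intros)

lemma integral_superset:
  fixes f :: "'a::euclidean_space \<Rightarrow> 'b::banach"
  assumes "S \<subseteq> T" "\<And>x. x \<in> T - S \<Longrightarrow> f x = 0"
  shows "integral S f = integral T f"
proof -
  have "(\<lambda>x. if x \<in> S then f x else 0) = (\<lambda>x. if x \<in> T then f x else 0)"
    using assms by (auto simp: fun_eq_iff)
  then show ?thesis
    using Henstock_Kurzweil_Integration.integral_restrict_UNIV[of S f]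
      Henstock_Kurzweil_Integration.integral_restrict_UNIV[of T f] by simp
qed

text \<open>The derivative at 0 of the integral of \<open>F\<close> along the flow is the integral
  of \<open>G\<close>; by \<open>integral_flow\<close> that integral does not change with the flow
  parameter, so the derivative is 0.\<close>

lemma has_integral_hderiv:
  assumes F: "continuous_on UNIV F" and G: "continuous_on UNIV G"
    and der: "\<And>x. has_hderiv i F (G x) x"
    and supp: "\<And>x. x \<notin> cbox a b \<Longrightarrow> F x = 0" "\<And>x. x \<notin> cbox a b \<Longrightarrow> G x = 0"
  shows "(G has_integral 0) (cbox a b)"
proof -
  define \<phi> where "\<phi> = (\<lambda>(s, x). x + s *\<^sub>R hfield i x)"
  have cont\<phi>: "continuous_on S \<phi>" for S
    unfolding \<phi>_def split_beta by (intro continuous_intros continuous_on_hfield)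
  \<comment> \<open>A single box that contains the image of the support under the flow for all
    parameters in [-1,1]. As the parameter range is symmetric, it also contains all preimages, so
    the domain of integration can be kept independent of \<open>s\<close>.\<close>
  have "compact (\<phi> ` ({-1..1} \<times> cbox a b))"
    by (intro compact_continuous_image cont\<phi> compact_Times) auto
  then obtain c where c: "\<phi> ` ({-1..1} \<times> cbox a b) \<subseteq> cbox (- c) c"
    using bounded_subset_cbox_symmetric compact_imp_bounded by blast
  have sub: "x \<in> cbox (- c) c" if "\<phi> (s, x) \<in> cbox a b" "s \<in> {-1..1}" for s x
  proof -
    have "\<phi> (- s, \<phi> (s, x)) = x"
      unfolding \<phi>_def by (simp add: hfield_line)
    moreover have "\<phi> (- s, \<phi> (s, x)) \<in> \<phi> ` ({-1..1} \<times> cbox a b)"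
      using that by (intro imageI) auto
    ultimately show ?thesis using c by auto
  qed
  have sub0: "cbox a b \<subseteq> cbox (- c) c"
    using sub[of 0] by (auto simp: \<phi>_def)
  have I: "integral (cbox (- c) c) (\<lambda>x. F (\<phi> (s, x))) = integral UNIV F" if "s \<in> {-1..1}" for s
  proof -
    have "integral (cbox (- c) c) (\<lambda>x. F (\<phi> (s, x))) = integral UNIV (\<lambda>x. F (\<phi> (s, x)))"
      using sub[OF _ that] supp by (intro integral_superset) auto
    then show ?thesis
      using integral_flow[OF F supp(1), where s=s and i=i] by (simp add: \<phi>_def)
  qed
  have "((\<lambda>s. integral (cbox (- c) c) (\<lambda>x. F (\<phi> (s, x)))) has_field_derivative
      integral (cbox (- c) c) (\<lambda>x. G (\<phi> (0, x)))) (at 0 within {-1<..<1})"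
  proof (rule leibniz_rule_field_derivative)
    show "((\<lambda>s. F (\<phi> (s, x))) has_real_derivative G (\<phi> (s, x))) (at s within {- 1<..<1})" for s x
      using has_hderiv_along_line[OF der] unfolding \<phi>_def
      by (auto intro: has_field_derivative_at_within)
    show "(\<lambda>x. F (\<phi> (s, x))) integrable_on cbox (- c) c" for s
      by (intro integrable_continuous continuous_on_compose2[OF F] continuous_on_compose2[OF cont\<phi>]
          continuous_intros) auto
    show "continuous_on ({- 1<..<1} \<times> cbox (- c) c) (\<lambda>(s, x). G (\<phi> (s, x)))"
      unfolding split_beta
      by (intro continuous_on_compose2[OF G] continuous_on_compose2[OF cont\<phi>]
          continuous_intros) auto
  qed auto
  then have "((\<lambda>s. integral (cbox (- c) c) (\<lambda>x. F (\<phi> (s, x)))) has_field_derivative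
      integral (cbox (- c) c) G) (at 0)"
    by (simp add: at_within_open[of 0 "{-1<..<1}"] \<phi>_def)
  then have "((\<lambda>s. integral UNIV F) has_field_derivative integral (cbox (- c) c) G) (at 0)"
    by (rule has_field_derivative_transform_within_open[where S = "{-1<..<1}"]) (auto simp: I)
  then have "integral (cbox (- c) c) G = 0"
    by (rule DERIV_unique[OF _ DERIV_const])
  moreover have "integral (cbox (- c) c) G = integral (cbox a b) G"
    using sub0 supp by (intro integral_superset[symmetric]) auto
  moreover have "G integrable_on cbox a b"
    using G by (intro integrable_continuous) (rule continuous_on_subset, auto)
  ultimately show ?thesis
    by (simp add: has_integral_integral)
qed

text \<open>Each summand is X_i applied to \<sigma> (\<psi> X_i u - u X_i \<psi>) - b_i u \<psi>,
  where the products X_i u X_i \<psi> cancel. The first part is Green's second identity, the second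
  moves the drift onto \<psi>. The compact support of \<psi> makes
  \<open>has_integral_hderiv\<close> applicable.\<close>

lemma green_identity:
  fixes u \<psi> :: "real^3 \<Rightarrow> real" and u1 u2 \<psi>1 \<psi>2 b b1 :: "2 \<Rightarrow> real^3 \<Rightarrow> real"
  assumes cont: "continuous_on UNIV u" "continuous_on UNIV \<psi>"
      "\<And>i. continuous_on UNIV (u1 i)" "\<And>i. continuous_on UNIV (u2 i)"
      "\<And>i. continuous_on UNIV (\<psi>1 i)" "\<And>i. continuous_on UNIV (\<psi>2 i)"
      "\<And>i. continuous_on UNIV (b i)" "\<And>i. continuous_on UNIV (b1 i)"
    and der: "\<And>i x. has_hderiv i u (u1 i x) x" "\<And>i x. has_hderiv i (u1 i) (u2 i x) x"
      "\<And>i x. has_hderiv i \<psi> (\<psi>1 i x) x" "\<And>i x. has_hderiv i (\<psi>1 i) (\<psi>2 i x) x"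
      "\<And>i x. has_hderiv i (b i) (b1 i x) x"
    and supp: "\<And>x. x \<notin> cbox p q \<Longrightarrow> \<psi> x = 0" "\<And>i x. x \<notin> cbox p q \<Longrightarrow> \<psi>1 i x = 0"
      "\<And>i x. x \<notin> cbox p q \<Longrightarrow> \<psi>2 i x = 0"
  shows "((\<lambda>x. (\<Sum>i\<in>UNIV. \<sigma> * (\<psi> x * u2 i x - u x * \<psi>2 i x)
      - (b i x * u1 i x * \<psi> x + b1 i x * u x * \<psi> x + b i x * u x * \<psi>1 i x))) has_integral 0) (cbox p q)"
proof -
  have "((\<lambda>x. \<sigma> * (\<psi> x * u2 i x - u x * \<psi>2 i x)
      - (b i x * u1 i x * \<psi> x + b1 i x * u x * \<psi> x + b i x * u x * \<psi>1 i x)) has_integral 0) (cbox p q)" for i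
  proof (rule has_integral_hderiv[where i=i and F="\<lambda>x. \<sigma> * (\<psi> x * u1 i x - u x * \<psi>1 i x) - b i x * (u x * \<psi> x)"])
    show "has_hderiv i (\<lambda>x. \<sigma> * (\<psi> x * u1 i x - u x * \<psi>1 i x) - b i x * (u x * \<psi> x))
        (\<sigma> * (\<psi> x * u2 i x - u x * \<psi>2 i x)
      - (b i x * u1 i x * \<psi> x + b1 i x * u x * \<psi> x + b i x * u x * \<psi>1 i x)) x" for x
    proof -
      have "has_hderiv i (\<lambda>x. \<sigma> * (\<psi> x * u1 i x - u x * \<psi>1 i x) - b i x * (u x * \<psi> x))
       (\<sigma> * ((\<psi>1 i x * u1 i x + u2 i x * \<psi> x) - (u1 i x * \<psi>1 i x + \<psi>2 i x * u x))
         - (b1 i x * (u x * \<psi> x) + (u1 i x * \<psi> x + \<psi>1 i x * u x) * b i x)) x"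
        by (intro has_hderiv_diff has_hderiv_cmult has_hderiv_mult der)
      then show ?thesis by (simp add: algebra_simps)
    qed
  qed (auto intro!: continuous_intros cont simp: supp)
  from has_integral_sum[OF finite this] show ?thesis
    by simp
qed

section \<open>A smooth majorant of the squared homogeneous norm\<close>

text \<open>The \<open>1\<close> under the root removes the singularity at the origin, and it gives
  \<open>gauge3 x\<close> >= 1, so that constants can later be absorbed into multiples of
  \<open>gauge3 x\<close>.\<close>

definition gauge3 :: "real^3 \<Rightarrow> real" where
  "gauge3 x = sqrt (1 + ((x$1)\<^sup>2 + (x$2)\<^sup>2)\<^sup>2 + (x$3)\<^sup>2)"

text \<open>\<open>quartic1 i\<close> and \<open>quartic2 i\<close> are \<open>X\<^sub>i\<close> and \<open>X\<^sub>i X\<^sub>i\<close> of the radicand of \<^const>\<open>gauge3\<close>;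
  \<open>gauge1 i\<close> and \<open>gauge2 i\<close> are those of \<^const>\<open>gauge3\<close> itself.\<close>

definition quartic1 :: "2 \<Rightarrow> real^3 \<Rightarrow> real" where
  "quartic1 i x = (if i = 1 then 4 * ((x$1)\<^sup>2 + (x$2)\<^sup>2) * x$1 - 2 * (x$2 * x$3)
    else 4 * ((x$1)\<^sup>2 + (x$2)\<^sup>2) * x$2 + 2 * (x$1 * x$3))"

definition quartic2 :: "2 \<Rightarrow> real^3 \<Rightarrow> real" where
  "quartic2 i x = (if i = 1 then 12 * (x$1)\<^sup>2 + 6 * (x$2)\<^sup>2 else 12 * (x$2)\<^sup>2 + 6 * (x$1)\<^sup>2)"

definition gauge1 :: "2 \<Rightarrow> real^3 \<Rightarrow> real" where
  "gauge1 i x = quartic1 i x / (2 * gauge3 x)"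

definition gauge2 :: "2 \<Rightarrow> real^3 \<Rightarrow> real" where
  "gauge2 i x = quartic2 i x / (2 * gauge3 x) - (quartic1 i x)\<^sup>2 / (4 * gauge3 x ^ 3)"

lemma gauge3_ge_1: "gauge3 x \<ge> 1"
  unfolding gauge3_def by simp

lemma gauge3_square: "(gauge3 x)\<^sup>2 = 1 + ((x$1)\<^sup>2 + (x$2)\<^sup>2)\<^sup>2 + (x$3)\<^sup>2"
  unfolding gauge3_def by simp

lemma has_hderiv_gauge3: "has_hderiv i gauge3 (gauge1 i x) x"
proof -
  have "has_hderiv i (\<lambda>x. 1 + ((x$1)\<^sup>2 + (x$2)\<^sup>2)\<^sup>2 + (x$3)\<^sup>2) (quartic1 i x) x"
    unfolding has_hderiv_def quartic1_def hfield_def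
    by (cases "i = 1") (auto intro!: derivative_eq_intros simp: axis_def algebra_simps)
  moreover have "(sqrt has_real_derivative inverse (gauge3 x) / 2)
      (at (1 + ((x$1)\<^sup>2 + (x$2)\<^sup>2)\<^sup>2 + (x$3)\<^sup>2))"
    unfolding gauge3_def by (rule DERIV_real_sqrt) (simp add: add_pos_nonneg)
  ultimately have "has_hderiv i (\<lambda>x. sqrt (1 + ((x$1)\<^sup>2 + (x$2)\<^sup>2)\<^sup>2 + (x$3)\<^sup>2))
      (inverse (gauge3 x) / 2 * quartic1 i x) x"
    by (rule has_hderiv_compose[rotated])
  then show ?thesis
    by (simp add: gauge1_def gauge3_def[abs_def] field_simps)
qed

lemma has_hderiv_gauge1: "has_hderiv i (gauge1 i) (gauge2 i x) x"
proof -
  have q: "has_hderiv i (quartic1 i) (quartic2 i x) x"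
    unfolding has_hderiv_def quartic1_def quartic2_def hfield_def
    by (cases "i = 1") (auto intro!: derivative_eq_intros simp: axis_def algebra_simps power2_eq_square)
  have g: "gauge3 x \<noteq> 0"
    using gauge3_ge_1[of x] by linarith
  have "((\<lambda>r. 1 / (2 * r)) has_real_derivative - 1 / (2 * (gauge3 x)\<^sup>2)) (at (gauge3 x))"
    using g by (auto intro!: derivative_eq_intros simp: power2_eq_square)
  from has_hderiv_mult[OF q has_hderiv_compose[OF this has_hderiv_gauge3[of i x]]]
  have "has_hderiv i (gauge1 i)
    (quartic2 i x * (1 / (2 * gauge3 x)) + - 1 / (2 * (gauge3 x)\<^sup>2) * gauge1 i x * quartic1 i x) x"
    by (simp add: gauge1_def[abs_def])
  also have "quartic2 i x * (1 / (2 * gauge3 x)) + - 1 / (2 * (gauge3 x)\<^sup>2) * gauge1 i x * quartic1 i x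
      = gauge2 i x"
    using g by (simp add: gauge1_def gauge2_def field_simps power2_eq_square power3_eq_cube)
  finally show ?thesis .
qed

lemma continuous_on_gauge:
  "continuous_on S gauge3" "continuous_on S (gauge1 i)" "continuous_on S (gauge2 i)"
proof -
  have g: "gauge3 x \<noteq> 0" for x
    using gauge3_ge_1[of x] by linarith
  show c: "continuous_on S gauge3"
    unfolding gauge3_def by (intro continuous_intros)
  have q: "continuous_on S (quartic1 i)" "continuous_on S (quartic2 i)"
    unfolding quartic1_def quartic2_def by (cases "i = 1"; auto intro!: continuous_intros)+
  show "continuous_on S (gauge1 i)" "continuous_on S (gauge2 i)"
    unfolding gauge1_def gauge2_def using g by (auto intro!: continuous_intros c q)
qed

lemma horizontal_square_le_gauge3: "(x$1)\<^sup>2 + (x$2)\<^sup>2 \<le> gauge3 x"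
  unfolding gauge3_def by (rule real_le_rsqrt) simp

text \<open>The mixed terms in x_1 x_2 x_3 of the two squares cancel. With r = x_1^2 + x_2^2 the sum
  equals 16 r^3 + 4 r x_3^2, and a factor r remains.\<close>

lemma quartic1_square_sum:
  "(\<Sum>i\<in>UNIV. (quartic1 i x)\<^sup>2) \<le> 16 * ((x$1)\<^sup>2 + (x$2)\<^sup>2) * (gauge3 x)\<^sup>2"
proof -
  let ?r = "(x$1)\<^sup>2 + (x$2)\<^sup>2"
  have "(\<Sum>i\<in>UNIV. (quartic1 i x)\<^sup>2) = 16 * ?r * ?r\<^sup>2 + 4 * ?r * (x$3)\<^sup>2"
    unfolding sum_2 quartic1_def by (simp add: power2_eq_square algebra_simps)
  also have "\<dots> \<le> 16 * ?r * ?r\<^sup>2 + 16 * ?r * (x$3)\<^sup>2"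
    by (intro add_left_mono mult_right_mono) auto
  also have "\<dots> \<le> 16 * ?r * (1 + ?r\<^sup>2 + (x$3)\<^sup>2)"
    by (simp add: algebra_simps)
  finally show ?thesis unfolding gauge3_square .
qed

text \<open>The remaining factor r is at most g. This linear growth is what allows the term of size
  \<beta>^2 |D_H g|^2, coming from the Laplacian of exp(-\<beta> g), to be dominated by the time
  derivative of the exponent.\<close>

lemma gauge1_square_sum: "(\<Sum>i\<in>UNIV. (gauge1 i x)\<^sup>2) \<le> 4 * gauge3 x"
proof -
  have g: "gauge3 x > 0"
    using gauge3_ge_1[of x] by linarith
  have "(\<Sum>i\<in>UNIV. (gauge1 i x)\<^sup>2) = (\<Sum>i\<in>UNIV. (quartic1 i x)\<^sup>2) / (4 * (gauge3 x)\<^sup>2)"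
    by (simp add: gauge1_def power_divide power_mult_distrib sum_divide_distrib)
  also have "\<dots> \<le> 16 * ((x$1)\<^sup>2 + (x$2)\<^sup>2) * (gauge3 x)\<^sup>2 / (4 * (gauge3 x)\<^sup>2)"
    by (intro divide_right_mono quartic1_square_sum) simp
  also have "\<dots> = 4 * ((x$1)\<^sup>2 + (x$2)\<^sup>2)"
    using g by simp
  also have "\<dots> \<le> 4 * gauge3 x"
    using horizontal_square_le_gauge3[of x] by simp
  finally show ?thesis .
qed

text \<open>The sum is 9 r / g minus a correction, with r = x_1^2 + x_2^2; the first lies in [0,9],
  the second in [0,4], and 13 is 9 + 4.\<close>

lemma gauge2_sum: "\<bar>\<Sum>i\<in>UNIV. gauge2 i x\<bar> \<le> 13"
proof -
  let ?r = "(x$1)\<^sup>2 + (x$2)\<^sup>2"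
  have g: "gauge3 x > 0" "gauge3 x \<ge> 1"
    using gauge3_ge_1[of x] by linarith+
  have r: "?r \<le> gauge3 x" "0 \<le> ?r"
    by (auto simp: horizontal_square_le_gauge3)
  have eq: "(\<Sum>i\<in>UNIV. gauge2 i x) = 9 * ?r / gauge3 x - (\<Sum>i\<in>UNIV. (quartic1 i x)\<^sup>2) / (4 * gauge3 x ^ 3)"
    unfolding sum_2 gauge2_def quartic2_def by (simp add: add_divide_distrib diff_divide_distrib field_simps)
  have 1: "0 \<le> 9 * ?r / gauge3 x" "9 * ?r / gauge3 x \<le> 9"
    using r g by (auto simp: divide_simps)
  have "(\<Sum>i\<in>UNIV. (quartic1 i x)\<^sup>2) / (4 * gauge3 x ^ 3) \<le>
      16 * ?r * (gauge3 x)\<^sup>2 / (4 * gauge3 x ^ 3)"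
    using g by (intro divide_right_mono quartic1_square_sum) simp
  also have "\<dots> = 4 * ?r / gauge3 x"
    using g by (simp add: field_simps power2_eq_square power3_eq_cube)
  also have "\<dots> \<le> 4"
    using r g by (auto simp: divide_simps)
  finally have 2: "(\<Sum>i\<in>UNIV. (quartic1 i x)\<^sup>2) / (4 * gauge3 x ^ 3) \<le> 4" .
  have "0 \<le> (\<Sum>i\<in>UNIV. (quartic1 i x)\<^sup>2) / (4 * gauge3 x ^ 3)"
    using g by (intro divide_nonneg_nonneg sum_nonneg) auto
  then show ?thesis using eq 1 2 by linarith
qed

text \<open>On the sublevel set x_1 and x_2 are at most sqrt R and x_3 at most R in absolute value;
  since R >= 1, the cube of half side R contains it.\<close>

lemma gauge3_le_imp_cbox:
  assumes "gauge3 x \<le> R" shows "x \<in> cbox (- R *\<^sub>R 1) (R *\<^sub>R 1)"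
proof -
  have R: "1 \<le> R" using gauge3_ge_1[of x] assms by linarith
  have sq: "\<bar>y\<bar> \<le> R" if "y\<^sup>2 \<le> R\<^sup>2" for y
    using that R abs_le_square_iff[of y R] by simp
  have "R \<le> R\<^sup>2" using R by (simp add: power2_eq_square)
  then have "(x$1)\<^sup>2 \<le> R\<^sup>2" "(x$2)\<^sup>2 \<le> R\<^sup>2"
    using horizontal_square_le_gauge3[of x] assms by (smt (verit) zero_le_power2)+
  moreover have "(x$3)\<^sup>2 \<le> R\<^sup>2"
  proof -
    have "(x$3)\<^sup>2 \<le> (gauge3 x)\<^sup>2" unfolding gauge3_square by simp
    also have "\<dots> \<le> R\<^sup>2" using assms gauge3_ge_1[of x] by (intro power_mono) auto
    finally show ?thesis .
  qed
  ultimately show ?thesis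
    using sq[of "x$1"] sq[of "x$2"] sq[of "x$3"]
    by (simp add: mem_box_cart forall_3 abs_le_iff)
qed

text \<open>By comparison of the fourth powers. It turns the growth condition in terms of
  \<open>hnorm\<close> into one in terms of \<open>gauge3\<close>.\<close>

lemma hnorm_square_le_gauge3: "(hnorm x)\<^sup>2 \<le> gauge3 x"
proof -
  let ?N = "((x $ 1)\<^sup>2 + (x $ 2)\<^sup>2)\<^sup>2 + (x $ 3)\<^sup>2"
  have "((hnorm x)\<^sup>2)\<^sup>2 = ?N"
    unfolding hnorm_def power_mult[symmetric] by (simp add: real_root_pow_pos2)
  also have "\<dots> \<le> (gauge3 x)\<^sup>2"
    unfolding gauge3_square by simp
  finally show ?thesis
    using gauge3_ge_1[of x] by (auto intro: power2_le_imp_le)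
qed

section \<open>A smooth absolute value and the weight\<close>

definition soft_abs :: "real \<Rightarrow> real" where "soft_abs y = sqrt (1 + y\<^sup>2) - 1"
definition soft_abs1 :: "real \<Rightarrow> real" where "soft_abs1 y = y / sqrt (1 + y\<^sup>2)"
definition soft_abs2 :: "real \<Rightarrow> real" where "soft_abs2 y = 1 / sqrt (1 + y\<^sup>2) ^ 3"

lemma soft_abs_deriv: "(soft_abs has_real_derivative soft_abs1 y) (at y)"
proof -
  have "1 + y\<^sup>2 > 0" by (simp add: add_pos_nonneg)
  then show ?thesis
    unfolding soft_abs_def soft_abs1_def by (auto intro!: derivative_eq_intros simp: field_simps)
qed

lemma soft_abs1_deriv: "(soft_abs1 has_real_derivative soft_abs2 y) (at y)"
proof -
  have p: "1 + y\<^sup>2 > 0" by (simp add: add_pos_nonneg)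
  then have s: "sqrt (1 + y\<^sup>2) \<noteq> 0" "sqrt (1 + y\<^sup>2) * sqrt (1 + y\<^sup>2) = 1 + y\<^sup>2" by auto
  have "((\<lambda>y. sqrt (1 + y\<^sup>2)) has_real_derivative y / sqrt (1 + y\<^sup>2)) (at y)"
    using DERIV_add[OF soft_abs_deriv[of y] DERIV_const[of 1]]
    by (simp add: soft_abs_def[abs_def] soft_abs1_def)
  note D = DERIV_divide[OF DERIV_ident this s(1)]
  have eq: "(1 * r - y * (y / r)) / (r * r) = 1 / r ^ 3" if "r \<noteq> 0" "r * r = 1 + y\<^sup>2" for r
  proof -
    have "1 * r - y * (y / r) = (r * r - y\<^sup>2) / r"
      using that(1) by (simp add: power2_eq_square diff_divide_distrib)
    then show ?thesis
      using that(2) by (simp add: power3_eq_cube)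
  qed
  show ?thesis
    unfolding soft_abs1_def[abs_def] soft_abs2_def
    by (rule DERIV_cong[OF D eq[OF s]])
qed

lemma continuous_on_soft_abs:
  "continuous_on S soft_abs" "continuous_on S soft_abs1" "continuous_on S soft_abs2"
proof -
  have "sqrt (1 + y\<^sup>2) \<noteq> 0" for y :: real
    by (smt (verit) real_sqrt_eq_zero_cancel_iff zero_le_power2)
  then show "continuous_on S soft_abs" "continuous_on S soft_abs1" "continuous_on S soft_abs2"
    unfolding soft_abs_def soft_abs1_def soft_abs2_def by (auto intro!: continuous_intros)
qed

lemma soft_abs_nonneg: "0 \<le> soft_abs y"
  unfolding soft_abs_def by simp

lemma soft_abs_le_abs: "soft_abs y \<le> \<bar>y\<bar>"
proof -
  have "sqrt (1 + y\<^sup>2) \<le> 1 + \<bar>y\<bar>"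
    by (rule real_le_lsqrt) (auto simp: power2_eq_square algebra_simps)
  then show ?thesis unfolding soft_abs_def by simp
qed

lemma soft_abs_eq_0: "soft_abs y = 0 \<longleftrightarrow> y = 0"
  unfolding soft_abs_def by simp

lemma soft_abs2_nonneg: "0 \<le> soft_abs2 y"
  unfolding soft_abs2_def by simp

text \<open>The factor \<open>2\<close> lets a fixed smoothing of the absolute value suffice: the zeroth order term is
  controlled by the energy itself, and no limit in a smoothing parameter has to be taken.\<close>

lemma soft_abs1_mult: "0 \<le> soft_abs1 y * y" "soft_abs1 y * y \<le> 2 * soft_abs y"
proof -
  define s where "s = sqrt (1 + y\<^sup>2)"
  have s: "s \<ge> 1" "s * s = 1 + y\<^sup>2"
    unfolding s_def by (auto simp: add_nonneg_nonneg)
  have e: "soft_abs1 y * y = (s * s - 1) / s"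
    unfolding soft_abs1_def s(2) by (simp add: s_def power2_eq_square)
  show "0 \<le> soft_abs1 y * y"
    unfolding soft_abs1_def by (simp add: power2_eq_square[symmetric])
  have "(s * s - 1) \<le> 2 * (s - 1) * s"
    using mult_nonneg_nonneg[of "s - 1" "s - 1"] s by (simp add: algebra_simps)
  then have "(s * s - 1) / s \<le> 2 * (s - 1)"
    using s by (simp add: divide_simps)
  then show "soft_abs1 y * y \<le> 2 * soft_abs y"
    unfolding e soft_abs_def s_def .
qed

text \<open>An exponent of at least 2 flattens the kink of the positive part at 0. Used twice, this
  shows that the third power is twice continuously differentiable.\<close>

lemma DERIV_max_0_power:
  "((\<lambda>y::real. max 0 y ^ Suc (Suc n)) has_real_derivative real (Suc (Suc n)) * max 0 y ^ Suc n) (at y)"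
proof -
  consider "y > 0" | "y < 0" | "y = 0" by linarith
  then show ?thesis
  proof cases
    case 1
    have "((\<lambda>y::real. y ^ Suc (Suc n)) has_real_derivative real (Suc (Suc n)) * max 0 y ^ Suc n) (at y)"
      using 1 DERIV_pow[of "Suc (Suc n)" y] by simp
    then show ?thesis
      by (rule has_field_derivative_transform_within_open[where S = "{0<..}"]) (use 1 in auto)
  next
    case 2
    have "((\<lambda>y::real. 0) has_real_derivative real (Suc (Suc n)) * max 0 y ^ Suc n) (at y)"
      using 2 by simp
    then show ?thesis
      by (rule has_field_derivative_transform_within_open[where S = "{..<0}"]) (use 2 in auto)
  next
    case 3
    \<comment> \<open>At the kink the difference quotient of the power is the next lower power of
      the positive part, which is continuous there with value 0; Caratheodory's criterion then gives
      the derivative.\<close>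
    have "isCont (\<lambda>z::real. max 0 z ^ Suc n) 0"
      by (intro continuous_intros)
    then show ?thesis
      unfolding 3 CARAT_DERIV
      by (intro exI[of _ "\<lambda>z. max 0 z ^ Suc n"]) (auto simp: max_def)
  qed
qed

section \<open>The cutoff and the truncated exponential weight\<close>

definition cutoff :: "real \<Rightarrow> real \<Rightarrow> real" where "cutoff R s = max 0 (1 - s / R)"

lemma cutoff_bounds: "0 \<le> cutoff R s" "R > 0 \<Longrightarrow> s \<ge> 0 \<Longrightarrow> cutoff R s \<le> 1"
  by (auto simp: cutoff_def)

lemma DERIV_cutoff_power:
  "((\<lambda>s. cutoff R s ^ Suc (Suc n)) has_real_derivative
      - real (Suc (Suc n)) * cutoff R s ^ Suc n / R) (at s)"
proof -
  have "((\<lambda>s. 1 - s / R) has_real_derivative (- 1 / R)) (at s)"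
    using DERIV_diff[OF DERIV_const DERIV_cdivide[OF DERIV_ident]] by simp
  then show ?thesis
    unfolding cutoff_def
    by (rule DERIV_cong[OF DERIV_chain2[OF DERIV_max_0_power]]) (simp del: power_Suc of_nat_Suc)
qed

text \<open>To be composed with \<open>gauge3\<close>. The cube of the cutoff makes the weight C^2;
  \<open>weight1\<close> and \<open>weight2\<close> are its first two derivatives in
  \<open>s\<close>.\<close>

definition weight :: "real \<Rightarrow> real \<Rightarrow> real \<Rightarrow> real" where
  "weight \<beta> R s = exp (- \<beta> * s) * cutoff R s ^ 3"
definition weight1 :: "real \<Rightarrow> real \<Rightarrow> real \<Rightarrow> real" where
  "weight1 \<beta> R s = - (exp (- \<beta> * s) * (3 * cutoff R s ^ 2 / R + \<beta> * cutoff R s ^ 3))"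
definition weight2 :: "real \<Rightarrow> real \<Rightarrow> real \<Rightarrow> real" where
  "weight2 \<beta> R s = exp (- \<beta> * s) *
     (6 * cutoff R s / R\<^sup>2 + 6 * \<beta> * cutoff R s ^ 2 / R + \<beta>\<^sup>2 * cutoff R s ^ 3)"

lemma weight_deriv: "(weight \<beta> R has_real_derivative weight1 \<beta> R s) (at s)"
  and weight1_deriv: "(weight1 \<beta> R has_real_derivative weight2 \<beta> R s) (at s)"
proof -
  have E: "((\<lambda>s. exp (- \<beta> * s)) has_real_derivative - \<beta> * exp (- \<beta> * s)) (at s)"
    by (auto intro!: derivative_eq_intros)
  have c3: "((\<lambda>s. cutoff R s ^ 3) has_real_derivative - 3 * (cutoff R s)\<^sup>2 / R) (at s)"
    using DERIV_cutoff_power[of R 1 s] by (simp add: numeral_3_eq_3 numeral_2_eq_2)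
  have c2: "((\<lambda>s. (cutoff R s)\<^sup>2) has_real_derivative - 2 * cutoff R s / R) (at s)"
    using DERIV_cutoff_power[of R 0 s] by (simp add: numeral_2_eq_2)
  show "(weight \<beta> R has_real_derivative weight1 \<beta> R s) (at s)"
    using DERIV_mult[OF E c3] by (simp add: weight_def[abs_def] weight1_def algebra_simps)
  show "(weight1 \<beta> R has_real_derivative weight2 \<beta> R s) (at s)"
    using DERIV_minus[OF DERIV_mult[OF E DERIV_add[OF
          DERIV_cdivide[OF DERIV_cmult[OF c2]] DERIV_cmult[OF c3]]]]
    unfolding weight1_def[abs_def] weight2_def
    by (rule DERIV_cong) (simp add: algebra_simps power2_eq_square)
qed

lemma continuous_on_cutoff: "continuous_on S f \<Longrightarrow> continuous_on S (\<lambda>x. cutoff R (f x))"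
  \<comment> \<open>For \<open>R = 0\<close> the quotient is 0 by convention and the cutoff is the
    constant 1.\<close>
  unfolding cutoff_def by (cases "R = 0") (auto intro!: continuous_intros)

lemma continuous_on_weight:
  "continuous_on S \<beta> \<Longrightarrow> continuous_on S f \<Longrightarrow> continuous_on S (\<lambda>x. weight (\<beta> x) R (f x))"
  "continuous_on S \<beta> \<Longrightarrow> continuous_on S f \<Longrightarrow> continuous_on S (\<lambda>x. weight1 (\<beta> x) R (f x))"
  "continuous_on S \<beta> \<Longrightarrow> continuous_on S f \<Longrightarrow> continuous_on S (\<lambda>x. weight2 (\<beta> x) R (f x))"
  unfolding weight_def weight1_def weight2_def
  by (cases "R = 0"; auto intro!: continuous_intros continuous_on_cutoff)+

lemma weight_nonneg: "0 \<le> weight \<beta> R s"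
  unfolding weight_def by (simp add: cutoff_bounds)

lemma weight_eq_0:
  assumes "R > 0" "s \<ge> R"
  shows "weight \<beta> R s = 0" "weight1 \<beta> R s = 0" "weight2 \<beta> R s = 0"
proof -
  have "cutoff R s = 0" using assms by (simp add: cutoff_def)
  then show "weight \<beta> R s = 0" "weight1 \<beta> R s = 0" "weight2 \<beta> R s = 0"
    by (simp_all add: weight_def weight1_def weight2_def)
qed

lemma weight_pos: "R > s \<Longrightarrow> s \<ge> 0 \<Longrightarrow> 0 < weight \<beta> R s"
  unfolding weight_def cutoff_def by (simp add: less_max_iff_disj)

text \<open>Keeps the energy of a fixed radius below the energies of all larger radii while the
  radius tends to infinity.\<close>

lemma weight_mono_radius:
  assumes "0 < R" "R \<le> R'" "0 \<le> s" shows "weight \<beta> R s \<le> weight \<beta> R' s"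
proof -
  have "s / R' \<le> s / R"
    using assms by (intro divide_left_mono) auto
  then have "cutoff R s \<le> cutoff R' s"
    unfolding cutoff_def by auto
  then show ?thesis
    unfolding weight_def by (intro mult_left_mono power_mono cutoff_bounds) auto
qed

text \<open>The total coefficient of g times the weight to be absorbed. With \<beta> <= 3\<alpha>
  the terms are 4 * 9\<alpha>^2 \<sigma> from |D_H g|^2, 13 * 3\<alpha> \<sigma> from the Laplacian
  of g, 2K * 3\<alpha> from the drift, and 2K + 2K from the divergence of the drift and the zeroth
  order term.\<close>

definition decay_rate :: "real \<Rightarrow> real \<Rightarrow> real \<Rightarrow> real" where
  "decay_rate \<sigma> \<alpha> K = 36 * \<sigma> * \<alpha>\<^sup>2 + 39 * \<sigma> * \<alpha> + 6 * K * \<alpha> + 4 * K"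
text \<open>The total coefficient of 1/R: 63 = 4 * 6 + 13 * 3, 72 = 4 * 18 and 6 = 2 * 3. The
  division by \<alpha> pays for replacing g exp(-2\<alpha> g) by exp(-\<alpha> g).\<close>

definition cutoff_error :: "real \<Rightarrow> real \<Rightarrow> real \<Rightarrow> real" where
  "cutoff_error \<sigma> \<alpha> K = (\<sigma> * (63 + 72 * \<alpha>) + 6 * K) / \<alpha>"

text \<open>The scalars stand for g = \<open>gauge3 x\<close>, q = |D_H g|^2, l the horizontal
  Laplacian of g, d the product of drift and D_H g, e the horizontal divergence of the drift, and
  \<kappa> the time derivative of \<beta>. The left side is then the adjoint operator applied to the
  weight, with the zeroth order term replaced by \<open>2 * K\<close>. Whatever does not carry 1/R
  is beaten by the term with \<kappa>.\<close>

lemma weight_supersolution: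
  fixes g :: real
  assumes g: "1 \<le> g" and R: "1 \<le> R" and \<alpha>: "0 < \<alpha>" and \<beta>: "2 * \<alpha> \<le> \<beta>" "\<beta> \<le> 3 * \<alpha>"
    and \<sigma>: "0 < \<sigma>" and K: "0 \<le> K" and \<kappa>: "decay_rate \<sigma> \<alpha> K \<le> \<kappa>"
    and q: "0 \<le> q" "q \<le> 4 * g" and l: "\<bar>l\<bar> \<le> 13" and d: "\<bar>d\<bar> \<le> 2 * K * g"
    and e: "\<bar>e\<bar> \<le> 2 * K"
  shows "- \<kappa> * g * weight \<beta> R g + \<sigma> * (weight2 \<beta> R g * q + weight1 \<beta> R g * l)
      + weight1 \<beta> R g * d + e * weight \<beta> R g + 2 * K * weight \<beta> R g
    \<le> cutoff_error \<sigma> \<alpha> K / R * exp (- \<alpha> * g)"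
proof -
  define E where "E = exp (- \<beta> * g)"
  define p where "p = cutoff R g ^ 3"
  have E: "E > 0" by (simp add: E_def)
  have c: "0 \<le> cutoff R g" "cutoff R g \<le> 1"
    using cutoff_bounds[of R g] R g by auto
  have p: "0 \<le> p" using c by (simp add: p_def)
  have c2: "0 \<le> cutoff R g ^ 2" "cutoff R g ^ 2 \<le> 1"
    using c by (auto intro: power_le_one)
  \<comment> \<open>\<open>E * A\<close> and \<open>E * B\<close> will bound \<open>weight2\<close>
    and the absolute value of \<open>weight1\<close>; in both the part of order 1/R is separated
    from the part proportional to the cubed cutoff \<open>p\<close>.\<close>
  define A where "A = (6 + 18 * \<alpha>) / R + 9 * \<alpha>\<^sup>2 * p"
  define B where "B = 3 / R + 3 * \<alpha> * p"
  have A: "A \<ge> 0" and B: "B \<ge> 0"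
    using R \<alpha> p by (auto simp: A_def B_def)
  have W: "weight \<beta> R g = E * p"
    by (simp add: weight_def E_def p_def)
  have W1: "\<bar>weight1 \<beta> R g\<bar> \<le> E * B"
  proof -
    have "3 * cutoff R g ^ 2 / R + \<beta> * cutoff R g ^ 3 \<le> B"
      unfolding B_def p_def using c2 R \<beta> c by (intro add_mono divide_right_mono mult_right_mono) auto
    moreover have "0 \<le> 3 * cutoff R g ^ 2 / R + \<beta> * cutoff R g ^ 3"
      using c R \<beta> \<alpha> by auto
    ultimately show ?thesis
      unfolding weight1_def E_def by (simp add: abs_mult)
  qed
  have W2: "0 \<le> weight2 \<beta> R g" "weight2 \<beta> R g \<le> E * A"
  proof -
    show "0 \<le> weight2 \<beta> R g"
      unfolding weight2_def using c R \<beta> \<alpha> by (intro mult_nonneg_nonneg add_nonneg_nonneg divide_nonneg_nonneg) auto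
    have "6 * cutoff R g / R\<^sup>2 \<le> 6 / R"
    proof -
      have "6 * cutoff R g / R\<^sup>2 \<le> 6 * 1 / R\<^sup>2"
        using c R by (intro divide_right_mono mult_left_mono) auto
      also have "\<dots> \<le> 6 / R"
        using R by (auto simp: divide_simps power2_eq_square)
      finally show ?thesis .
    qed
    moreover have "6 * \<beta> * cutoff R g ^ 2 / R \<le> 6 * (3 * \<alpha>) * 1 / R"
      using c2 R \<beta> \<alpha> by (intro divide_right_mono mult_mono) auto
    moreover have "\<beta>\<^sup>2 * cutoff R g ^ 3 \<le> (3 * \<alpha>)\<^sup>2 * p"
      unfolding p_def using c \<beta> \<alpha> by (intro mult_right_mono power_mono) auto
    ultimately have "6 * cutoff R g / R\<^sup>2 + 6 * \<beta> * cutoff R g ^ 2 / R + \<beta>\<^sup>2 * cutoff R g ^ 3 \<le> A"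
      unfolding A_def by (simp add: add_divide_distrib power_mult_distrib)
    then show "weight2 \<beta> R g \<le> E * A"
      unfolding weight2_def E_def by (intro mult_left_mono) auto
  qed
  have t1: "\<sigma> * (weight2 \<beta> R g * q) \<le> \<sigma> * (E * A * (4 * g))"
    using \<sigma> W2 q g A E by (intro mult_left_mono mult_mono) auto
  have absprod: "x * y \<le> X * Y" if "\<bar>x\<bar> \<le> X" "\<bar>y\<bar> \<le> Y" for x y X Y :: real
  proof -
    have "x * y \<le> \<bar>x\<bar> * \<bar>y\<bar>" by (simp add: abs_mult[symmetric])
    also have "\<dots> \<le> X * Y" using that by (intro mult_mono) auto
    finally show ?thesis .
  qed
  have "weight1 \<beta> R g * l \<le> E * B * (13 * g)"
    using W1 l g by (intro absprod) auto
  then have t2: "\<sigma> * (weight1 \<beta> R g * l) \<le> \<sigma> * (E * B * (13 * g))"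
    using \<sigma> by (intro mult_left_mono) auto
  have t3: "weight1 \<beta> R g * d \<le> E * B * (2 * K * g)"
    by (rule absprod[OF W1 d])
  have "2 * K * 1 \<le> 2 * K * g" using K g by (intro mult_left_mono) auto
  then have "(e + 2 * K) * (E * p) \<le> (4 * K * g) * (E * p)"
    using e E p by (intro mult_right_mono) auto
  then have t4: "e * weight \<beta> R g + 2 * K * weight \<beta> R g \<le> 4 * K * g * (E * p)"
    unfolding W by (simp add: algebra_simps)
  have "decay_rate \<sigma> \<alpha> K * (g * (E * p)) \<le> \<kappa> * (g * (E * p))"
    using \<kappa> g E p by (intro mult_right_mono) auto
  then have t5: "- \<kappa> * g * weight \<beta> R g \<le> - decay_rate \<sigma> \<alpha> K * g * (E * p)"
    unfolding W by (simp add: algebra_simps)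
  have "- \<kappa> * g * weight \<beta> R g + \<sigma> * (weight2 \<beta> R g * q + weight1 \<beta> R g * l)
      + weight1 \<beta> R g * d + e * weight \<beta> R g + 2 * K * weight \<beta> R g
    \<le> - decay_rate \<sigma> \<alpha> K * g * (E * p) + \<sigma> * (E * A * (4 * g)) + \<sigma> * (E * B * (13 * g))
      + E * B * (2 * K * g) + 4 * K * g * (E * p)"
    using t1 t2 t3 t4 t5 by (simp only: distrib_left)
  \<comment> \<open>All terms with \<open>p\<close> cancel by the choice of
    \<open>decay_rate\<close>, and only those of order 1/R survive.\<close>
  also have "\<dots> = (\<sigma> * (63 + 72 * \<alpha>) + 6 * K) / R * (g * E)"
    using R unfolding A_def B_def decay_rate_def by (simp add: field_simps power2_eq_square)
  also have "\<dots> \<le> (\<sigma> * (63 + 72 * \<alpha>) + 6 * K) / R * (exp (- \<alpha> * g) / \<alpha>)"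
  proof (rule mult_left_mono)
    \<comment> \<open>Since \<beta> >= 2\<alpha>, one factor exp(-\<alpha> g) can be spent on
      absorbing the factor g, and the other is kept.\<close>
    have "\<alpha> * g \<le> exp (\<alpha> * g)"
      using exp_ge_add_one_self[of "\<alpha> * g"] by linarith
    have "g * E \<le> g * exp (- (2 * \<alpha>) * g)"
      using \<beta> g unfolding E_def by (intro mult_left_mono) auto
    also have "\<dots> = (\<alpha> * g) * exp (- (2 * \<alpha>) * g) / \<alpha>"
      using \<alpha> by simp
    also have "\<dots> \<le> exp (\<alpha> * g) * exp (- (2 * \<alpha>) * g) / \<alpha>"
      using \<alpha> \<open>\<alpha> * g \<le> exp (\<alpha> * g)\<close> by (intro divide_right_mono mult_right_mono) auto
    also have "\<dots> = exp (- \<alpha> * g) / \<alpha>"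
      by (simp add: exp_add[symmetric] algebra_simps)
    finally show "g * E \<le> exp (- \<alpha> * g) / \<alpha>" .
  qed (use R \<sigma> \<alpha> K in auto)
  also have "\<dots> = cutoff_error \<sigma> \<alpha> K / R * exp (- \<alpha> * g)"
    by (simp add: cutoff_error_def)
  finally show ?thesis .
qed

section \<open>The weighted energy\<close>

lemma sum_inner_2: "(\<Sum>i\<in>UNIV. v $ i * w i) = v \<bullet> (\<chi> i. w i)" for v :: "real^2"
  by (simp add: inner_vec_def)

text \<open>By Cauchy-Schwarz, with |D_H g| <= 2 sqrt g <= 2 g because g >= 1.\<close>

lemma drift_bound:
  fixes v :: "real^2"
  assumes "norm v \<le> K"
  shows "\<bar>\<Sum>i\<in>UNIV. v $ i * gauge1 i x\<bar> \<le> 2 * K * gauge3 x"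
proof -
  let ?G = "(\<chi> i. gauge1 i x) :: real^2"
  have K: "0 \<le> K" using assms norm_ge_zero order_trans by blast
  have "(norm ?G)\<^sup>2 \<le> 4 * gauge3 x"
    using gauge1_square_sum[of x] by (simp add: norm_vec_def L2_set_def sum_nonneg)
  also have "\<dots> \<le> (2 * gauge3 x)\<^sup>2"
    using gauge3_ge_1[of x] by (simp add: power2_eq_square)
  finally have n: "norm ?G \<le> 2 * gauge3 x"
    using gauge3_ge_1[of x] by (auto intro: power2_le_imp_le)
  have "\<bar>v \<bullet> ?G\<bar> \<le> norm v * norm ?G"
    by (rule Cauchy_Schwarz_ineq2)
  also have "\<dots> \<le> K * (2 * gauge3 x)"
    using assms n K by (intro mult_mono) auto
  finally show ?thesis by (simp add: sum_inner_2)
qed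

text \<open>With \<kappa> the slope of \<beta>, the left side is the time derivative of the energy
  at a fixed time. Subtracting an integrand of zero integral transfers the spatial operator to the
  weight, after which the inequality holds pointwise.\<close>

lemma spatial_estimate:
  fixes b :: "real^3 \<Rightarrow> real^2" and m mt c :: "real^3 \<Rightarrow> real" and m1 m2 b1 :: "2 \<Rightarrow> real^3 \<Rightarrow> real"
  assumes R: "1 \<le> R" and \<alpha>: "0 < \<alpha>" and \<beta>: "2 * \<alpha> \<le> \<beta>" "\<beta> \<le> 3 * \<alpha>"
    and \<sigma>: "0 < \<sigma>" and K: "0 \<le> K" and \<kappa>: "decay_rate \<sigma> \<alpha> K \<le> \<kappa>"
    and cont: "continuous_on UNIV m" "continuous_on UNIV mt" "continuous_on UNIV b"
      "\<And>i. continuous_on UNIV (m1 i)" "\<And>i. continuous_on UNIV (m2 i)" "\<And>i. continuous_on UNIV (b1 i)"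
    and der: "\<And>i x. has_hderiv i m (m1 i x) x" "\<And>i x. has_hderiv i (m1 i) (m2 i x) x"
      "\<And>i x. has_hderiv i (\<lambda>y. b y $ i) (b1 i x) x"
    and bounds: "\<And>x. norm (b x) \<le> K" "\<And>x. \<bar>c x\<bar> \<le> K" "\<And>i x. \<bar>b1 i x\<bar> \<le> K"
    and pde: "\<And>x. mt x = \<sigma> * (\<Sum>i\<in>UNIV. m2 i x) - (\<Sum>i\<in>UNIV. b x $ i * m1 i x) - c x * m x"
  defines "Q \<equiv> cbox (- R *\<^sub>R 1) (R *\<^sub>R 1) :: (real^3) set"
  shows "integral Q (\<lambda>x. soft_abs1 (m x) * mt x * weight \<beta> R (gauge3 x)
        + soft_abs (m x) * (- \<kappa> * gauge3 x * weight \<beta> R (gauge3 x)))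
     \<le> cutoff_error \<sigma> \<alpha> K / R * integral Q (\<lambda>x. \<bar>m x\<bar> * exp (- \<alpha> * gauge3 x))"
proof -
  define \<psi> where "\<psi> x = weight \<beta> R (gauge3 x)" for x
  define \<psi>1 where "\<psi>1 i x = weight1 \<beta> R (gauge3 x) * gauge1 i x" for i x
  define \<psi>2 where "\<psi>2 i x = weight2 \<beta> R (gauge3 x) * (gauge1 i x)\<^sup>2 + weight1 \<beta> R (gauge3 x) * gauge2 i x" for i x
  define u where "u x = soft_abs (m x)" for x
  define u1 where "u1 i x = soft_abs1 (m x) * m1 i x" for i x
  define u2 where "u2 i x = soft_abs2 (m x) * (m1 i x)\<^sup>2 + soft_abs1 (m x) * m2 i x" for i x
  have ders: "has_hderiv i u (u1 i x) x" "has_hderiv i (u1 i) (u2 i x) x"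
      "has_hderiv i \<psi> (\<psi>1 i x) x" "has_hderiv i (\<psi>1 i) (\<psi>2 i x) x" for i x
  proof -
    show "has_hderiv i u (u1 i x) x"
      unfolding u_def u1_def by (rule has_hderiv_compose[OF soft_abs_deriv der(1)])
    show "has_hderiv i \<psi> (\<psi>1 i x) x"
      unfolding \<psi>_def \<psi>1_def by (rule has_hderiv_compose[OF weight_deriv has_hderiv_gauge3])
    show "has_hderiv i (u1 i) (u2 i x) x"
      using has_hderiv_mult[OF has_hderiv_compose[OF soft_abs1_deriv der(1)] der(2)]
      by (simp add: u1_def[abs_def] u2_def power2_eq_square algebra_simps)
    show "has_hderiv i (\<psi>1 i) (\<psi>2 i x) x"
      using has_hderiv_mult[OF has_hderiv_compose[OF weight1_deriv has_hderiv_gauge3] has_hderiv_gauge1]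
      by (simp add: \<psi>1_def[abs_def] \<psi>2_def power2_eq_square algebra_simps)
  qed
  note cs = continuous_on_compose2[OF continuous_on_soft_abs(1)[of UNIV]]
    continuous_on_compose2[OF continuous_on_soft_abs(2)[of UNIV]]
    continuous_on_compose2[OF continuous_on_soft_abs(3)[of UNIV]]
  have conts: "continuous_on UNIV u" "continuous_on UNIV \<psi>"
      "\<And>i. continuous_on UNIV (u1 i)" "\<And>i. continuous_on UNIV (u2 i)"
      "\<And>i. continuous_on UNIV (\<psi>1 i)" "\<And>i. continuous_on UNIV (\<psi>2 i)"
    unfolding u_def u1_def u2_def \<psi>_def \<psi>1_def \<psi>2_def
    by (auto intro!: continuous_intros cs cont continuous_on_weight continuous_on_gauge)
  have contb: "continuous_on UNIV (\<lambda>x. b x $ i)" for i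
    using cont(3) by (intro continuous_intros)
  have out: "R \<le> gauge3 x" if "x \<notin> Q" for x
    using gauge3_le_imp_cbox[of x R] that unfolding Q_def by linarith
  have supp: "\<psi> x = 0" "\<psi>1 i x = 0" "\<psi>2 i x = 0" if "x \<notin> Q" for i x
    using weight_eq_0[of R "gauge3 x" \<beta>] out[OF that] R unfolding \<psi>_def \<psi>1_def \<psi>2_def by auto
  \<comment> \<open>The horizontal divergence of the Green and drift terms; its integral vanishes,
    so it may be subtracted freely.\<close>
  define H where "H x = (\<Sum>i\<in>UNIV. \<sigma> * (\<psi> x * u2 i x - u x * \<psi>2 i x)
      - (b x $ i * u1 i x * \<psi> x + b1 i x * u x * \<psi> x + b x $ i * u x * \<psi>1 i x))" for x
  have H: "(H has_integral 0) Q"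
    unfolding H_def[abs_def] Q_def
    by (rule green_identity[where b="\<lambda>i x. b x $ i"])
      (use supp[unfolded Q_def] in \<open>auto intro: conts contb cont ders der\<close>)
  define D where "D x = soft_abs1 (m x) * mt x * \<psi> x + u x * (- \<kappa> * gauge3 x * \<psi> x)" for x
  define J where "J x = cutoff_error \<sigma> \<alpha> K / R * (\<bar>m x\<bar> * exp (- \<alpha> * gauge3 x))" for x
  have "D integrable_on Q" "J integrable_on Q"
    unfolding D_def[abs_def] J_def[abs_def] Q_def u_def \<psi>_def
    using R by (auto intro!: integrable_continuous continuous_intros cs continuous_on_subset[OF cont(1)]
        continuous_on_subset[OF cont(2)] continuous_on_weight continuous_on_gauge)
  have "D x - H x \<le> J x" for x
  proof -
    let ?g = "gauge3 x"
    define q where "q = (\<Sum>i\<in>UNIV. (gauge1 i x)\<^sup>2)"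
    define l where "l = (\<Sum>i\<in>UNIV. gauge2 i x)"
    define d where "d = (\<Sum>i\<in>UNIV. b x $ i * gauge1 i x)"
    define e where "e = (\<Sum>i\<in>UNIV. b1 i x)"
    define L where "L = - \<kappa> * ?g * weight \<beta> R ?g + \<sigma> * (weight2 \<beta> R ?g * q + weight1 \<beta> R ?g * l)
      + weight1 \<beta> R ?g * d + e * weight \<beta> R ?g + 2 * K * weight \<beta> R ?g"
    have "\<bar>e\<bar> \<le> 2 * K"
      unfolding e_def sum_2 using bounds(3)[of 1 x] bounds(3)[of 2 x] by linarith
    then have L: "L \<le> cutoff_error \<sigma> \<alpha> K / R * exp (- \<alpha> * ?g)"
      unfolding L_def using R \<alpha> \<beta> \<sigma> K \<kappa> gauge3_ge_1 gauge1_square_sum[of x] gauge2_sum[of x]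
        drift_bound[OF bounds(1), of x x]
      by (intro weight_supersolution) (auto simp: q_def l_def d_def sum_nonneg)
    have \<psi>0: "0 \<le> \<psi> x" and u0: "0 \<le> u x"
      by (auto simp: \<psi>_def u_def weight_nonneg soft_abs_nonneg)
    \<comment> \<open>After subtraction the derivatives of \<open>m\<close> occur only in the square
      term, which has a good sign because \<open>soft_abs\<close> is convex. The
      \<open>2 * K\<close> contained in \<open>L\<close> is set aside for the term with
      \<open>c\<close>.\<close>
    have "D x - H x = - \<sigma> * \<psi> x * soft_abs2 (m x) * (\<Sum>i\<in>UNIV. (m1 i x)\<^sup>2)
        - c x * (soft_abs1 (m x) * m x) * \<psi> x + u x * (L - 2 * K * \<psi> x)"
      unfolding D_def H_def pde L_def q_def l_def d_def e_def sum_2 u1_def u2_def \<psi>1_def \<psi>2_def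
        \<psi>_def[symmetric]
      by (simp add: algebra_simps)
    also have "\<dots> \<le> u x * L"
    proof -
      have "0 \<le> \<sigma> * \<psi> x * soft_abs2 (m x) * (\<Sum>i\<in>UNIV. (m1 i x)\<^sup>2)"
        using \<sigma> \<psi>0 soft_abs2_nonneg by (intro mult_nonneg_nonneg sum_nonneg) auto
      \<comment> \<open>The bound S'(m) m <= 2 S(m) turns the zeroth order term into at most
        \<open>2 * K\<close> times the energy density, which is exactly the amount set aside in
        \<open>L\<close>.\<close>
      moreover have "- c x * (soft_abs1 (m x) * m x) * \<psi> x \<le> K * (2 * u x) * \<psi> x"
      proof (rule mult_right_mono[OF _ \<psi>0], rule mult_mono)
        show "- c x \<le> K" using bounds(2)[of x] by linarith
      qed (use K soft_abs1_mult[of "m x"] in \<open>auto simp: u_def\<close>)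
      ultimately show ?thesis by (simp add: algebra_simps)
    qed
    also have "\<dots> \<le> u x * (cutoff_error \<sigma> \<alpha> K / R * exp (- \<alpha> * ?g))"
      using L u0 by (rule mult_left_mono)
    also have "\<dots> \<le> \<bar>m x\<bar> * (cutoff_error \<sigma> \<alpha> K / R * exp (- \<alpha> * ?g))"
      using soft_abs_le_abs[of "m x"] R \<sigma> K \<alpha> unfolding u_def cutoff_error_def
      by (intro mult_right_mono) auto
    finally show ?thesis unfolding J_def by (simp add: algebra_simps)
  qed
  then have "integral Q (\<lambda>x. D x - H x) \<le> integral Q J"
    using \<open>D integrable_on Q\<close> \<open>J integrable_on Q\<close> H
    by (intro integral_le integrable_diff) auto
  moreover have "integral Q (\<lambda>x. D x - H x) = integral Q D"
    using \<open>D integrable_on Q\<close> H by (simp add: integral_diff has_integral_integrable integral_unique)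
  moreover have "integral Q J = cutoff_error \<sigma> \<alpha> K / R * integral Q (\<lambda>x. \<bar>m x\<bar> * exp (- \<alpha> * gauge3 x))"
    unfolding J_def[abs_def] by (rule integral_mult_right)
  ultimately show ?thesis
    by (simp add: D_def[abs_def] u_def \<psi>_def)
qed

section \<open>Evolution of the energy over one time step\<close>

lemma continuous_on_swap:
  assumes "continuous_on (A \<times> B) (\<lambda>(x, t). f x t)" "C \<subseteq> A" "D \<subseteq> B"
  shows "continuous_on (D \<times> C) (\<lambda>(t, x). f x t)"
proof -
  have "continuous_on (D \<times> C) (\<lambda>p. (\<lambda>(x, t). f x t) (snd p, fst p))"
    using assms(2,3) by (intro continuous_on_compose2[OF assms(1)] continuous_intros) auto
  then show ?thesis by (simp add: split_beta)
qed

lemma continuous_on_slice: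
  assumes "continuous_on (UNIV \<times> J) (\<lambda>(x, t). f x t)" "t \<in> J"
  shows "continuous_on UNIV (\<lambda>x. f x t)"
proof -
  have "continuous_on UNIV (\<lambda>x. (\<lambda>(x, t). f x t) (x, t))"
    by (rule continuous_on_compose2[OF assms(1)]) (use assms(2) in \<open>auto intro!: continuous_intros\<close>)
  then show ?thesis by simp
qed

text \<open>\<open>spatial_estimate\<close> is integrated over time with a \<beta> that rises
  linearly from 2\<alpha> to 3\<alpha>; the energy vanishes at \<open>t0\<close> because
  \<open>m\<close> does.\<close>

lemma energy_estimate:
  fixes b :: "real^3 \<Rightarrow> real \<Rightarrow> real^2" and m mt c :: "real^3 \<Rightarrow> real \<Rightarrow> real"
    and m1 m2 b1 :: "2 \<Rightarrow> real^3 \<Rightarrow> real \<Rightarrow> real"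
  assumes R: "1 \<le> R" and \<alpha>: "0 < \<alpha>" and \<sigma>: "0 < \<sigma>" and K: "0 \<le> K"
    and t: "t0 < t1" "decay_rate \<sigma> \<alpha> K * (t1 - t0) \<le> \<alpha>"
    and cont: "continuous_on (UNIV \<times> {t0..t1}) (\<lambda>(x, t). m x t)"
      "continuous_on (UNIV \<times> {t0<..<t1}) (\<lambda>(x, t). mt x t)"
      "\<And>t. t \<in> {t0<..<t1} \<Longrightarrow> continuous_on UNIV (\<lambda>x. b x t)"
      "\<And>i t. t \<in> {t0<..<t1} \<Longrightarrow> continuous_on UNIV (\<lambda>x. m1 i x t)"
      "\<And>i t. t \<in> {t0<..<t1} \<Longrightarrow> continuous_on UNIV (\<lambda>x. m2 i x t)"
      "\<And>i t. t \<in> {t0<..<t1} \<Longrightarrow> continuous_on UNIV (\<lambda>x. b1 i x t)"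
    and der: "\<And>x t. t \<in> {t0<..<t1} \<Longrightarrow> (m x has_real_derivative mt x t) (at t)"
      "\<And>i x t. t \<in> {t0<..<t1} \<Longrightarrow> has_hderiv i (\<lambda>y. m y t) (m1 i x t) x"
      "\<And>i x t. t \<in> {t0<..<t1} \<Longrightarrow> has_hderiv i (\<lambda>y. m1 i y t) (m2 i x t) x"
      "\<And>i x t. t \<in> {t0<..<t1} \<Longrightarrow> has_hderiv i (\<lambda>y. b y t $ i) (b1 i x t) x"
    and bounds: "\<And>x t. t \<in> {t0<..<t1} \<Longrightarrow> norm (b x t) \<le> K"
      "\<And>x t. t \<in> {t0<..<t1} \<Longrightarrow> \<bar>c x t\<bar> \<le> K" "\<And>i x t. t \<in> {t0<..<t1} \<Longrightarrow> \<bar>b1 i x t\<bar> \<le> K"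
    and pde: "\<And>x t. t \<in> {t0<..<t1} \<Longrightarrow>
        mt x t = \<sigma> * (\<Sum>i\<in>UNIV. m2 i x t) - (\<Sum>i\<in>UNIV. b x t $ i * m1 i x t) - c x t * m x t"
    and init: "\<And>x. m x t0 = 0"
  defines "Q \<equiv> cbox (- R *\<^sub>R 1) (R *\<^sub>R 1) :: (real^3) set"
  shows "integral Q (\<lambda>x. soft_abs (m x t1) * weight (3 * \<alpha>) R (gauge3 x)) \<le>
    cutoff_error \<sigma> \<alpha> K / R * integral {t0..t1} (\<lambda>t. integral Q (\<lambda>x. \<bar>m x t\<bar> * exp (- \<alpha> * gauge3 x)))"
proof -
  \<comment> \<open>The slope that raises \<beta> by \<alpha> over the step; the restriction on the
    step length says precisely that this slope is at least \<open>decay_rate\<close>.\<close>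
  define \<kappa> where "\<kappa> = \<alpha> / (t1 - t0)"
  define \<beta> where "\<beta> t = 2 * \<alpha> + \<kappa> * (t - t0)" for t
  have \<kappa>: "decay_rate \<sigma> \<alpha> K \<le> \<kappa>" "0 \<le> \<kappa>"
    using t \<alpha> by (auto simp: \<kappa>_def field_simps)
  have \<beta>1: "\<beta> t1 = 3 * \<alpha>"
    using t by (simp add: \<beta>_def \<kappa>_def)
  have \<beta>: "2 * \<alpha> \<le> \<beta> t" "\<beta> t \<le> 3 * \<alpha>" if "t \<in> {t0<..<t1}" for t
  proof -
    show "2 * \<alpha> \<le> \<beta> t" using that \<kappa> by (simp add: \<beta>_def)
    have "\<beta> t \<le> \<beta> t1" using that \<kappa> by (auto simp: \<beta>_def intro!: mult_left_mono)
    then show "\<beta> t \<le> 3 * \<alpha>" by (simp add: \<beta>1)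
  qed
  note cs = continuous_on_compose2[OF continuous_on_soft_abs(1)[of UNIV]]
    continuous_on_compose2[OF continuous_on_soft_abs(2)[of UNIV]]
  note cg = continuous_on_compose2[OF continuous_on_gauge(1)[of UNIV]]
  have c\<beta>: "continuous_on S f \<Longrightarrow> continuous_on S (\<lambda>x. \<beta> (f x))" for S f
    unfolding \<beta>_def by (intro continuous_intros)
  define f where "f t x = soft_abs (m x t) * weight (\<beta> t) R (gauge3 x)" for t x
  define f' where "f' t x = soft_abs1 (m x t) * mt x t * weight (\<beta> t) R (gauge3 x)
        + soft_abs (m x t) * (- \<kappa> * gauge3 x * weight (\<beta> t) R (gauge3 x))" for t x
  define J where "J t = integral Q (\<lambda>x. \<bar>m x t\<bar> * exp (- \<alpha> * gauge3 x))" for t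
  have cm: "continuous_on ({t0..t1} \<times> Q) (\<lambda>p. m (snd p) (fst p))"
    using continuous_on_swap[OF cont(1)] by (simp add: split_beta)
  have cm': "continuous_on ({t0<..<t1} \<times> Q) (\<lambda>p. m (snd p) (fst p))"
    by (rule continuous_on_subset[OF cm]) auto
  have cmt: "continuous_on ({t0<..<t1} \<times> Q) (\<lambda>p. mt (snd p) (fst p))"
    using continuous_on_swap[OF cont(2)] by (simp add: split_beta)
  have cf: "continuous_on ({t0..t1} \<times> Q) (\<lambda>(t, x). f t x)"
    unfolding f_def split_beta
    by (intro continuous_intros cs[OF cm] continuous_on_weight c\<beta> cg) auto
  have cf': "continuous_on ({t0<..<t1} \<times> Q) (\<lambda>(t, x). f' t x)"
    unfolding f'_def split_beta
    by (intro continuous_intros cs[OF cm'] cmt continuous_on_weight c\<beta> cg) auto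
  have cJ: "continuous_on {t0..t1} J"
    unfolding J_def Q_def
    by (rule integral_continuous_on_param)
      (unfold split_beta, intro continuous_intros cm[unfolded Q_def] cg, auto)
  have deriv: "((\<lambda>t. integral Q (f t)) has_real_derivative integral Q (f' t)) (at t)"
    if t: "t \<in> {t0<..<t1}" for t
  proof -
    have "((\<lambda>t. integral Q (f t)) has_real_derivative integral Q (f' t)) (at t within {t0<..<t1})"
      unfolding Q_def
    proof (rule leibniz_rule_field_derivative)
      fix s x assume s: "s \<in> {t0<..<t1}"
      have "((\<lambda>t. exp (- \<beta> t * g)) has_real_derivative - \<kappa> * g * exp (- \<beta> s * g)) (at s)" for g
      proof -
        have "(\<beta> has_real_derivative \<kappa>) (at s)"
          unfolding \<beta>_def by (auto intro!: derivative_eq_intros)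
        then show ?thesis
          by (intro DERIV_cong[OF DERIV_chain2[OF DERIV_exp DERIV_cmult_right[OF DERIV_minus]]]) auto
      qed
      from DERIV_cmult_right[OF this, of "gauge3 x" "cutoff R (gauge3 x) ^ 3"]
      have "((\<lambda>t. weight (\<beta> t) R (gauge3 x)) has_real_derivative
          - \<kappa> * gauge3 x * weight (\<beta> s) R (gauge3 x)) (at s)"
        by (simp add: weight_def algebra_simps)
      from DERIV_mult[OF DERIV_chain2[OF soft_abs_deriv der(1)[OF s]] this]
      have "((\<lambda>t. f t x) has_real_derivative f' s x) (at s)"
        unfolding f_def f'_def by (rule DERIV_cong) (simp add: algebra_simps)
      then show "((\<lambda>t. f t x) has_real_derivative f' s x) (at s within {t0<..<t1})"
        by (rule has_field_derivative_at_within)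
    next
      fix s assume s: "s \<in> {t0<..<t1}"
      show "f s integrable_on cbox (- R *\<^sub>R 1) (R *\<^sub>R 1)"
        unfolding f_def using s
        by (intro integrable_continuous continuous_intros cs continuous_on_weight cg
            continuous_on_subset[OF continuous_on_slice[OF cont(1)]]) auto
    qed (use that cf' in \<open>auto simp: Q_def\<close>)
    then show ?thesis
      by (metis at_within_open open_greaterThanLessThan t)
  qed
  \<comment> \<open>The equation is available at interior times only; at the endpoints continuity of
    the energy is enough for the fundamental theorem.\<close>
  have "((\<lambda>t. integral Q (f' t)) has_integral integral Q (f t1) - integral Q (f t0)) {t0..t1}"
  proof (rule fundamental_theorem_of_calculus_interior)
    show "continuous_on {t0..t1} (\<lambda>t. integral Q (f t))"
      unfolding Q_def by (rule integral_continuous_on_param) (use cf in \<open>simp add: Q_def\<close>)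
  qed (use t deriv in \<open>auto simp: has_real_derivative_iff_has_vector_derivative[symmetric]\<close>)
  then have 1: "((\<lambda>t. integral Q (f' t)) has_integral integral Q (f t1) - integral Q (f t0)) {t0<..<t1}"
    using has_integral_Icc_iff_Ioo by blast
  have "((\<lambda>t. cutoff_error \<sigma> \<alpha> K / R * J t) has_integral cutoff_error \<sigma> \<alpha> K / R * integral {t0..t1} J) {t0..t1}"
    by (intro has_integral_mult_right integrable_integral integrable_continuous_interval cJ)
  then have 2: "((\<lambda>t. cutoff_error \<sigma> \<alpha> K / R * J t) has_integral cutoff_error \<sigma> \<alpha> K / R * integral {t0..t1} J) {t0<..<t1}"
    using has_integral_Icc_iff_Ioo by blast
  have le: "integral Q (f' t) \<le> cutoff_error \<sigma> \<alpha> K / R * J t" if "t \<in> {t0<..<t1}" for t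
    unfolding f'_def J_def Q_def
    by (rule spatial_estimate[where b = "\<lambda>x. b x t" and c = "\<lambda>x. c x t" and ?b1.0 = "\<lambda>i x. b1 i x t"
          and ?m1.0 = "\<lambda>i x. m1 i x t" and ?m2.0 = "\<lambda>i x. m2 i x t"])
      (use that R \<alpha> \<beta>[OF that] \<sigma> K \<kappa> cont der bounds pde
        continuous_on_slice[OF cont(1)] continuous_on_slice[OF cont(2)] in auto)
  have "f t0 = (\<lambda>x. 0)"
    by (simp add: f_def fun_eq_iff init soft_abs_eq_0)
  then have "integral Q (f t0) = 0"
    by simp
  with has_integral_le[OF 1 2 le] show ?thesis
    unfolding J_def[abs_def] f_def[abs_def] \<beta>1 by simp
qed


section \<open>The limit of infinite radius\<close>

lemma zero_if_energy_le_over_radius: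
  fixes m :: "real^3 \<Rightarrow> real \<Rightarrow> real"
  assumes cont: "continuous_on UNIV (\<lambda>x. m x t)" and C: "0 \<le> C"
    and le: "\<And>R. 1 \<le> R \<Longrightarrow>
       integral (cbox (- R *\<^sub>R 1) (R *\<^sub>R 1)) (\<lambda>x. soft_abs (m x t) * weight \<gamma> R (gauge3 x)) \<le> C / R"
  shows "m x t = 0"
proof -
  define Q where "Q R = (cbox (- R *\<^sub>R 1) (R *\<^sub>R 1) :: (real^3) set)" for R :: real
  define f where "f R x = soft_abs (m x t) * weight \<gamma> R (gauge3 x)" for R x
  have cf: "continuous_on S (f R)" for S R
    unfolding f_def
    by (intro continuous_intros continuous_on_weight continuous_on_gauge
        continuous_on_compose2[OF continuous_on_soft_abs(1)[of UNIV]] continuous_on_subset[OF cont]) auto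
  have f0: "0 \<le> f R x" for R x
    by (simp add: f_def soft_abs_nonneg weight_nonneg)
  \<comment> \<open>A fixed radius whose weight is positive at \<open>x\<close>. Its energy is at
    most C/R for every larger R, hence 0, and a continuous nonnegative integrand with integral 0
    vanishes at \<open>x\<close>.\<close>
  define r where "r = 2 * gauge3 x"
  have r: "1 \<le> r" "gauge3 x < r" using gauge3_ge_1[of x] by (auto simp: r_def)
  have "integral (Q r) (f r) \<le> C / R" if "r \<le> R" for R
  proof -
    have "integral (Q r) (f r) \<le> integral (Q r) (f R)"
      unfolding Q_def
    proof (intro integral_le integrable_continuous cf)
      show "f r y \<le> f R y" for y
        unfolding f_def using r that gauge3_ge_1[of y]
        by (intro mult_left_mono weight_mono_radius soft_abs_nonneg) auto
    qed
    also have "\<dots> \<le> integral (Q R) (f R)"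
      unfolding Q_def
    proof (intro integral_subset_le integrable_continuous cf)
      show "cbox (- r *\<^sub>R 1) (r *\<^sub>R 1) \<subseteq> cbox (- R *\<^sub>R 1) (R *\<^sub>R 1 :: real^3)"
        using that by (auto simp: mem_box_cart) (meson order_trans neg_le_iff_le)+
    qed (use f0 in auto)
    also have "\<dots> \<le> C / R"
      using le[of R] r that by (simp add: f_def[abs_def] Q_def)
    finally show ?thesis .
  qed
  then have "eventually (\<lambda>R. integral (Q r) (f r) \<le> C / R) at_top"
    by (rule eventually_mono[OF eventually_ge_at_top])
  moreover have "((\<lambda>R. C / R) \<longlongrightarrow> 0) at_top"
    by (intro tendsto_divide_0[OF tendsto_const] filterlim_at_top_imp_at_infinity filterlim_ident)
  ultimately have "integral (Q r) (f r) \<le> 0"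
    by (intro tendsto_le[OF _ _ tendsto_const, of at_top "\<lambda>R. C / R"]) auto
  moreover have "0 \<le> integral (Q r) (f r)"
    using f0 unfolding Q_def by (intro integral_nonneg integrable_continuous cf) auto
  ultimately have "integral (Q r) (f r) = 0"
    by (rule antisym)
  then have "(f r has_integral 0) (Q r)"
    using integrable_integral[OF integrable_continuous[OF cf, of r]] unfolding Q_def by metis
  then have "f r x = 0"
    unfolding Q_def
  proof (rule has_integral_0_cbox_imp_0[OF cf f0])
    have "(0::real^3) \<in> box (- r *\<^sub>R 1) (r *\<^sub>R 1)" using r by (simp add: mem_box_cart)
    then show "box (- r *\<^sub>R 1) (r *\<^sub>R 1 :: real^3) \<noteq> {}" by blast
    show "x \<in> cbox (- r *\<^sub>R 1) (r *\<^sub>R 1)"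
      using r by (intro gauge3_le_imp_cbox) auto
  qed
  then show ?thesis
    using weight_pos[of "gauge3 x" r \<gamma>] r gauge3_ge_1[of x] by (auto simp: f_def soft_abs_eq_0)
qed

text \<open>The finite integral over the whole cylinder dominates the integral over each box,
  uniformly in the radius; on a box the integrand is continuous, so the iterated integral equals the
  double one.\<close>

lemma weighted_integral_bound:
  fixes m :: "real^3 \<Rightarrow> real \<Rightarrow> real"
  assumes cont: "continuous_on (UNIV \<times> {0..T}) (\<lambda>(x, t). m x t)"
    and \<alpha>: "0 < \<alpha>" and I: "{t0..t1} \<subseteq> {0..T}"
    and fin: "(\<integral>\<^sup>+(x, t)\<in>UNIV \<times> {0..T}.
            ennreal (\<bar>m x t\<bar> * exp (- \<alpha> * ((hnorm x)\<^sup>2 + 1))) \<partial>lborel) < \<infinity>"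
  shows "\<exists>M\<ge>0. \<forall>R. integral {t0..t1} (\<lambda>t. integral (cbox (- R *\<^sub>R 1) (R *\<^sub>R 1))
            (\<lambda>x. \<bar>m x t\<bar> * exp (- \<alpha> * gauge3 x))) \<le> M"
proof -
  define A where "A = (\<integral>\<^sup>+(x, t)\<in>UNIV \<times> {0..T}.
            ennreal (\<bar>m x t\<bar> * exp (- \<alpha> * ((hnorm x)\<^sup>2 + 1))) \<partial>lborel)"
  have A: "A = ennreal (enn2real A)" using fin unfolding A_def by simp
  show ?thesis
  proof (intro exI[of _ "exp \<alpha> * enn2real A"] conjI allI)
    \<comment> \<open>The factor exp \<alpha> in the bound compensates for the summand 1 in the
      exponent of the growth condition.\<close>
    fix R :: real
    define a where "a = (- R *\<^sub>R 1 :: real^3)"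
    define d where "d = (R *\<^sub>R 1 :: real^3)"
    define h where "h = (\<lambda>(t, x). \<bar>m x t\<bar> * exp (- \<alpha> * (gauge3 x + 1)))"
    define h' where "h' = (\<lambda>(x, t). \<bar>m x t\<bar> * exp (- \<alpha> * (gauge3 x + 1)))"
    have ch: "continuous_on (cbox (a, t0) (d, t1)) h'"
      unfolding h'_def split_beta
      by (intro continuous_intros continuous_on_compose2[OF continuous_on_gauge(1)[of UNIV]]
         continuous_on_subset[OF cont[unfolded split_beta]])
         (use I in \<open>auto simp: cbox_Pair_eq\<close>)
    define V where "V = integral (cbox (a, t0) (d, t1)) h'"
    have "ennreal V = (\<integral>\<^sup>+p. ennreal (h' p) * indicator (cbox (a, t0) (d, t1)) p \<partial>lborel)"
      unfolding V_def
    proof (rule nn_integral_has_integral_lebesgue'[symmetric])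
      show "0 \<le> h' p" for p by (cases p) (simp add: h'_def)
    qed (intro integrable_integral integrable_continuous ch)
    also have "\<dots> \<le> A"
      unfolding A_def
    proof (rule nn_integral_mono)
      fix p :: "(real^3) \<times> real"
      obtain x t where p: "p = (x, t)" by force
      have "exp (- \<alpha> * (gauge3 x + 1)) \<le> exp (- \<alpha> * ((hnorm x)\<^sup>2 + 1))"
        using hnorm_square_le_gauge3[of x] \<alpha> by simp
      then have "\<bar>m x t\<bar> * exp (- \<alpha> * (gauge3 x + 1)) \<le> \<bar>m x t\<bar> * exp (- \<alpha> * ((hnorm x)\<^sup>2 + 1))"
        by (intro mult_left_mono) auto
      then show "ennreal (h' p) * indicator (cbox (a, t0) (d, t1)) p \<le>
         (case p of (x, t) \<Rightarrow> ennreal (\<bar>m x t\<bar> * exp (- \<alpha> * ((hnorm x)\<^sup>2 + 1)))) * indicator (UNIV \<times> {0..T}) p"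
        using I by (auto simp: p h'_def cbox_Pair_eq intro!: ennreal_leI split: split_indicator)
    qed
    finally have "V \<le> enn2real A"
      using A by (metis enn2real_nonneg ennreal_le_iff)
    have ch2: "continuous_on (cbox (t0, a) (t1, d)) (\<lambda>p. h' (snd p, fst p))"
      by (intro continuous_on_compose2[OF ch] continuous_intros) (auto simp: cbox_Pair_eq)
    have "V = integral (cbox t0 t1) (\<lambda>t. integral (cbox a d) (\<lambda>x. h' (x, t)))"
      unfolding V_def integral_prod_continuous[OF ch]
      by (rule integral_swap_continuous) (use ch in simp)
    also have "\<dots> = integral {t0..t1} (\<lambda>t. exp (- \<alpha>) * integral (cbox a d) (\<lambda>x. \<bar>m x t\<bar> * exp (- \<alpha> * gauge3 x)))"
    proof -
      have "h' (x, t) = exp (- \<alpha>) * (\<bar>m x t\<bar> * exp (- \<alpha> * gauge3 x))" for x t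
        by (simp add: h'_def exp_add[symmetric] algebra_simps)
      then show ?thesis by (simp only: integral_mult_right cbox_interval)
    qed
    also have "\<dots> = exp (- \<alpha>) * integral {t0..t1} (\<lambda>t. integral (cbox a d) (\<lambda>x. \<bar>m x t\<bar> * exp (- \<alpha> * gauge3 x)))"
      by (rule integral_mult_right)
    finally have "integral {t0..t1} (\<lambda>t. integral (cbox a d) (\<lambda>x. \<bar>m x t\<bar> * exp (- \<alpha> * gauge3 x))) = exp \<alpha> * V"
      by (simp add: exp_minus)
    also have "\<dots> \<le> exp \<alpha> * enn2real A"
      using \<open>V \<le> enn2real A\<close> by simp
    finally show "integral {t0..t1} (\<lambda>t. integral (cbox (- R *\<^sub>R 1) (R *\<^sub>R 1))
            (\<lambda>x. \<bar>m x t\<bar> * exp (- \<alpha> * gauge3 x))) \<le> exp \<alpha> * enn2real A"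
      unfolding a_def d_def .
  qed simp
qed

text \<open>Restriction to the open time interval, where the derivative relative to (0,T] is the
  ordinary one. The equation is solved for the time derivative, and the inner product with the
  gradient becomes a sum over components.\<close>

lemma classical_solution_props:
  assumes sol: "classical_solution T \<sigma> b c m0 m"
  shows "continuous_on (UNIV \<times> {0..T}) (\<lambda>(x, t). m x t)"
    and "\<And>x. m x 0 = m0 x"
    and "continuous_on (UNIV \<times> {0<..<T}) (\<lambda>(x, t). deriv (m x) t)"
    and "\<And>x t. t \<in> {0<..<T} \<Longrightarrow> (m x has_real_derivative deriv (m x) t) (at t)"
    and "\<And>i x t. t \<in> {0<..<T} \<Longrightarrow> has_hderiv i (\<lambda>y. m y t) (hderiv i (\<lambda>y. m y t) x) x"
    and "\<And>i x t. t \<in> {0<..<T} \<Longrightarrow>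
       has_hderiv i (hderiv i (\<lambda>y. m y t)) (hderiv i (hderiv i (\<lambda>y. m y t)) x) x"
    and "\<And>i t. t \<in> {0<..<T} \<Longrightarrow> continuous_on UNIV (\<lambda>x. hderiv i (\<lambda>y. m y t) x)"
    and "\<And>i t. t \<in> {0<..<T} \<Longrightarrow> continuous_on UNIV (\<lambda>x. hderiv i (hderiv i (\<lambda>y. m y t)) x)"
    and "\<And>x t. t \<in> {0<..<T} \<Longrightarrow> deriv (m x) t = \<sigma> * (\<Sum>i\<in>UNIV. hderiv i (hderiv i (\<lambda>y. m y t)) x)
        - (\<Sum>i\<in>UNIV. b x t $ i * hderiv i (\<lambda>y. m y t) x) - c x t * m x t"
proof -
  have C: "C2H {0<..T} m" using sol unfolding classical_solution_def by blast
  have at: "at t within {0<..T} = at t" if "t \<in> {0<..<T}" for t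
    by (rule at_within_nhd[where S = "{0<..<T}"]) (use that in auto)
  show "continuous_on (UNIV \<times> {0..T}) (\<lambda>(x, t). m x t)" "\<And>x. m x 0 = m0 x"
    using sol unfolding classical_solution_def by blast+
  have "continuous_on (UNIV \<times> {0<..<T}) (\<lambda>(x, t). vector_derivative (m x) (at t within {0<..T}))"
    using C unfolding C2H_def by (auto elim: continuous_on_subset)
  then show "continuous_on (UNIV \<times> {0<..<T}) (\<lambda>(x, t). deriv (m x) t)"
    by (rule continuous_on_eq) (auto simp: at field_derivative_eq_vector_derivative)
  show "(m x has_real_derivative deriv (m x) t) (at t)" if t: "t \<in> {0<..<T}" for x t
  proof -
    have "m x differentiable (at t within {0<..T})"
      using C t unfolding C2H_def by auto
    then show ?thesis
      unfolding at[OF t] using DERIV_deriv_iff_real_differentiable by blast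
  qed
  fix i :: 2 and t :: real assume t: "t \<in> {0<..<T}"
  then have t': "t \<in> {0<..T}" by auto
  show "has_hderiv i (\<lambda>y. m y t) (hderiv i (\<lambda>y. m y t) x) x" for x
    using C t' unfolding C2H_def by (intro has_hderiv_hderiv) blast
  show "has_hderiv i (hderiv i (\<lambda>y. m y t)) (hderiv i (hderiv i (\<lambda>y. m y t)) x) x" for x
    using C t' unfolding C2H_def by (intro has_hderiv_hderiv) blast
  have "continuous_on (UNIV \<times> {0<..T}) (\<lambda>(x, t). hderiv i (\<lambda>y. m y t) x)"
    "continuous_on (UNIV \<times> {0<..T}) (\<lambda>(x, t). hderiv i (hderiv i (\<lambda>y. m y t)) x)"
    using C unfolding C2H_def by blast+
  from this[THEN continuous_on_slice, OF t']
  show "continuous_on UNIV (\<lambda>x. hderiv i (\<lambda>y. m y t) x)"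
    "continuous_on UNIV (\<lambda>x. hderiv i (hderiv i (\<lambda>y. m y t)) x)" .
next
  show "deriv (m x) t = \<sigma> * (\<Sum>i\<in>UNIV. hderiv i (hderiv i (\<lambda>y. m y t)) x)
        - (\<Sum>i\<in>UNIV. b x t $ i * hderiv i (\<lambda>y. m y t) x) - c x t * m x t"
    if "t \<in> {0<..<T}" for x t
  proof -
    have "deriv (m x) t - \<sigma> * hlaplacian (\<lambda>y. m y t) x + b x t \<bullet> hgrad (\<lambda>y. m y t) x + c x t * m x t = 0"
      using sol that unfolding classical_solution_def by blast
    then show ?thesis
      unfolding hlaplacian_def hgrad_def sum_inner_2 by linarith
  qed
qed

section \<open>Uniqueness by iteration over short time steps\<close>

theorem propositionB1:
  fixes T \<sigma> \<alpha> :: real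
    and b :: "real^3 \<Rightarrow> real \<Rightarrow> real^2"
    and c :: "real^3 \<Rightarrow> real \<Rightarrow> real"
    and m\<^sub>0 :: "real^3 \<Rightarrow> real"
    and m\<^sub>1 m\<^sub>2 :: "real^3 \<Rightarrow> real \<Rightarrow> real"
  assumes "T > 0" and "\<sigma> > 0"
    and "continuous_on (UNIV \<times> {0..T}) (\<lambda>(x, t). b x t)"
    and "bounded ((\<lambda>(x, t). b x t) ` (UNIV \<times> {0..T}))"
    and "continuous_on (UNIV \<times> {0..T}) (\<lambda>(x, t). c x t)"
    and "bounded ((\<lambda>(x, t). c x t) ` (UNIV \<times> {0..T}))"
    and "\<And>i j x t. t \<in> {0..T} \<Longrightarrow> hdifferentiable i (\<lambda>y. b y t $ j) x"
    and "\<And>i j. continuous_on (UNIV \<times> {0..T}) (\<lambda>(x, t). hderiv i (\<lambda>y. b y t $ j) x)"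
    and "\<And>i j. bounded ((\<lambda>(x, t). hderiv i (\<lambda>y. b y t $ j) x) ` (UNIV \<times> {0..T}))"
    and "classical_solution T \<sigma> b c m\<^sub>0 m\<^sub>1"
    and "classical_solution T \<sigma> b c m\<^sub>0 m\<^sub>2"
    and "\<alpha> > 0"
    and "(\<integral>\<^sup>+(x, t)\<in>UNIV \<times> {0..T}.
            ennreal (\<bar>m\<^sub>1 x t\<bar> * exp (- \<alpha> * ((hnorm x)\<^sup>2 + 1))) \<partial>lborel) < \<infinity>"
    and "(\<integral>\<^sup>+(x, t)\<in>UNIV \<times> {0..T}.
            ennreal (\<bar>m\<^sub>2 x t\<bar> * exp (- \<alpha> * ((hnorm x)\<^sup>2 + 1))) \<partial>lborel) < \<infinity>"
  shows "\<forall>x. \<forall>t\<in>{0..T}. m\<^sub>1 x t = m\<^sub>2 x t"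
proof -
  note sol1 = classical_solution_props[OF assms(10)]
  note sol2 = classical_solution_props[OF assms(11)]
  define m where "m x t = m\<^sub>1 x t - m\<^sub>2 x t" for x t
  define mt where "mt x t = deriv (m\<^sub>1 x) t - deriv (m\<^sub>2 x) t" for x t
  define d1 where "d1 i x t = hderiv i (\<lambda>y. m\<^sub>1 y t) x - hderiv i (\<lambda>y. m\<^sub>2 y t) x" for i x t
  define d2 where "d2 i x t = hderiv i (hderiv i (\<lambda>y. m\<^sub>1 y t)) x - hderiv i (hderiv i (\<lambda>y. m\<^sub>2 y t)) x" for i x t
  \<comment> \<open>Only the diagonal derivatives X_i b_i are used: they are the terms of the
    horizontal divergence of the drift.\<close>
  define b1 where "b1 i x t = hderiv i (\<lambda>y. b y t $ i) x" for i x t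
  have "\<exists>K. \<forall>x. \<forall>t\<in>{0..T}. norm (b x t) \<le> K"
    using assms(4) unfolding bounded_iff by auto
  then obtain Kb where Kb: "norm (b x t) \<le> Kb" if "t \<in> {0..T}" for x t
    by blast
  have "\<exists>K. \<forall>x. \<forall>t\<in>{0..T}. \<bar>c x t\<bar> \<le> K"
    using assms(6) unfolding bounded_iff by auto
  then obtain Kc where Kc: "\<bar>c x t\<bar> \<le> Kc" if "t \<in> {0..T}" for x t
    by blast
  have "\<forall>i. \<exists>K. \<forall>x. \<forall>t\<in>{0..T}. \<bar>b1 i x t\<bar> \<le> K"
    using assms(9) unfolding bounded_iff b1_def by auto
  then obtain Kd where Kd: "\<bar>b1 i x t\<bar> \<le> Kd i" if "t \<in> {0..T}" for i x t
    by metis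
  define K where "K = \<bar>Kb\<bar> + \<bar>Kc\<bar> + (\<Sum>i\<in>UNIV. \<bar>Kd i\<bar>)"
  have Ks: "0 \<le> K" "Kb \<le> K" "Kc \<le> K" "Kd i \<le> K" for i
  proof -
    have "\<bar>Kd i\<bar> \<le> (\<Sum>i\<in>UNIV. \<bar>Kd i\<bar>)" by (rule member_le_sum) auto
    then show "0 \<le> K" "Kb \<le> K" "Kc \<le> K" "Kd i \<le> K"
      unfolding K_def by linarith+
  qed
  have cm: "continuous_on (UNIV \<times> {0..T}) (\<lambda>(x, t). m x t)"
    using continuous_on_diff[OF sol1(1) sol2(1)] by (simp add: m_def split_beta)
  \<comment> \<open>Vanishing propagates across any step of admissible length; the step may start at
    0 and end at \<open>T\<close>, since the equation is used only strictly in between.\<close>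
  have step: "m x t1 = 0"
    if t: "0 \<le> t0" "t0 < t1" "t1 \<le> T" "decay_rate \<sigma> \<alpha> K * (t1 - t0) \<le> \<alpha>" and init: "\<And>x. m x t0 = 0"
    for t0 t1 x
  proof -
    have sub: "{t0..t1} \<subseteq> {0..T}" "{t0<..<t1} \<subseteq> {0<..<T}" using t by auto
    define N where "N f R = integral {t0..t1} (\<lambda>t. integral (cbox (- R *\<^sub>R 1) (R *\<^sub>R 1))
            (\<lambda>x. \<bar>f x t\<bar> * exp (- \<alpha> * gauge3 x)))" for f :: "real^3 \<Rightarrow> real \<Rightarrow> real" and R :: real
    obtain M1 where M1: "0 \<le> M1" "\<And>R. N m\<^sub>1 R \<le> M1"
      using weighted_integral_bound[OF sol1(1) assms(12) sub(1) assms(13)] unfolding N_def by blast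
    obtain M2 where M2: "0 \<le> M2" "\<And>R. N m\<^sub>2 R \<le> M2"
      using weighted_integral_bound[OF sol2(1) assms(12) sub(1) assms(14)] unfolding N_def by blast
    \<comment> \<open>The growth condition passes to the difference by the triangle inequality, with
      a bound independent of \<open>R\<close>.\<close>
    have N: "N m R \<le> M1 + M2" for R
    proof -
      define Q where "Q = (cbox (- R *\<^sub>R 1) (R *\<^sub>R 1) :: (real^3) set)"
      define J where "J f t = integral Q (\<lambda>x. \<bar>f x t\<bar> * exp (- \<alpha> * gauge3 x))"
        for f :: "real^3 \<Rightarrow> real \<Rightarrow> real" and t
      have slice: "(\<lambda>x. \<bar>f x t\<bar> * exp (- \<alpha> * gauge3 x)) integrable_on Q"
        if "continuous_on (UNIV \<times> {0..T}) (\<lambda>(x, t). f x t)" "t \<in> {t0..t1}" for f :: "real^3 \<Rightarrow> real \<Rightarrow> real" and t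
        unfolding Q_def using that sub
        by (intro integrable_continuous continuous_intros continuous_on_gauge
            continuous_on_subset[OF continuous_on_slice[OF that(1)]]) auto
      have J: "J f integrable_on {t0..t1}"
        if "continuous_on (UNIV \<times> {0..T}) (\<lambda>(x, t). f x t)" for f :: "real^3 \<Rightarrow> real \<Rightarrow> real"
      proof -
        have "continuous_on ({t0..t1} \<times> Q) (\<lambda>(t, x). f x t)"
          by (rule continuous_on_swap[OF that]) (use sub in auto)
        then have "continuous_on {t0..t1} (J f)"
          unfolding J_def Q_def split_beta
          by (intro integral_continuous_on_param)
            (unfold split_beta, intro continuous_intros continuous_on_compose2[OF continuous_on_gauge(1)[of UNIV]], auto)
        then show ?thesis by (rule integrable_continuous_interval)
      qed
      have "J m t \<le> J m\<^sub>1 t + J m\<^sub>2 t" if "t \<in> {t0..t1}" for t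
      proof -
        have "J m t \<le> integral Q (\<lambda>x. \<bar>m\<^sub>1 x t\<bar> * exp (- \<alpha> * gauge3 x) + \<bar>m\<^sub>2 x t\<bar> * exp (- \<alpha> * gauge3 x))"
          unfolding J_def
        proof (intro integral_le slice[OF cm that] integrable_add slice[OF sol1(1) that] slice[OF sol2(1) that])
          show "\<bar>m x t\<bar> * exp (- \<alpha> * gauge3 x) \<le> \<bar>m\<^sub>1 x t\<bar> * exp (- \<alpha> * gauge3 x) + \<bar>m\<^sub>2 x t\<bar> * exp (- \<alpha> * gauge3 x)" for x
            unfolding m_def distrib_right[symmetric] by (intro mult_right_mono) auto
        qed
        also have "\<dots> = J m\<^sub>1 t + J m\<^sub>2 t"
          unfolding J_def by (intro integral_add slice[OF sol1(1) that] slice[OF sol2(1) that])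
        finally show ?thesis .
      qed
      then have "integral {t0..t1} (J m) \<le> integral {t0..t1} (\<lambda>t. J m\<^sub>1 t + J m\<^sub>2 t)"
        using J[OF cm] J[OF sol1(1)] J[OF sol2(1)] by (intro integral_le integrable_add)
      also have "\<dots> = integral {t0..t1} (J m\<^sub>1) + integral {t0..t1} (J m\<^sub>2)"
        by (intro integral_add J sol1(1) sol2(1))
      finally show ?thesis
        using M1(2)[of R] M2(2)[of R] unfolding N_def J_def[abs_def] Q_def by linarith
    qed
    have error_nonneg: "0 \<le> cutoff_error \<sigma> \<alpha> K"
      using assms Ks(1) unfolding cutoff_error_def by simp
    show ?thesis
    proof (rule zero_if_energy_le_over_radius[where m = m and t = t1 and C = "cutoff_error \<sigma> \<alpha> K * (M1 + M2)" and \<gamma> = "3 * \<alpha>"])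
      show "continuous_on UNIV (\<lambda>x. m x t1)"
        using t by (intro continuous_on_slice[OF cm]) auto
      show "0 \<le> cutoff_error \<sigma> \<alpha> K * (M1 + M2)"
        using error_nonneg M1(1) M2(1) by simp
      fix R :: real assume R: "1 \<le> R"
      have "integral (cbox (- R *\<^sub>R 1) (R *\<^sub>R 1)) (\<lambda>x. soft_abs (m x t1) * weight (3 * \<alpha>) R (gauge3 x))
          \<le> cutoff_error \<sigma> \<alpha> K / R * N m R"
        unfolding N_def
      proof (rule energy_estimate[where b = b and c = c and mt = mt and ?m1.0 = d1 and ?m2.0 = d2 and ?b1.0 = b1])
        show "continuous_on (UNIV \<times> {t0..t1}) (\<lambda>(x, t). m x t)"
          by (rule continuous_on_subset[OF cm]) (use sub in auto)
        have "continuous_on (UNIV \<times> {0<..<T}) (\<lambda>(x, t). mt x t)"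
          using continuous_on_diff[OF sol1(3) sol2(3)] by (simp add: mt_def split_beta)
        then show "continuous_on (UNIV \<times> {t0<..<t1}) (\<lambda>(x, t). mt x t)"
          by (rule continuous_on_subset) (use sub in auto)
      next
        fix i x s assume "s \<in> {t0<..<t1}"
        then have s: "s \<in> {0<..<T}" "s \<in> {0..T}" using sub by auto
        show "continuous_on UNIV (\<lambda>x. b x s)"
          using assms(3) s(2) by (rule continuous_on_slice)
        show "continuous_on UNIV (\<lambda>x. b1 i x s)"
          unfolding b1_def using assms(8) s(2) by (rule continuous_on_slice)
        show "continuous_on UNIV (\<lambda>x. d1 i x s)"
          unfolding d1_def by (intro continuous_on_diff sol1(7) sol2(7) s)
        show "continuous_on UNIV (\<lambda>x. d2 i x s)"
          unfolding d2_def by (intro continuous_on_diff sol1(8) sol2(8) s)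
        show "(m x has_real_derivative mt x s) (at s)"
          unfolding m_def[abs_def] mt_def by (intro DERIV_diff sol1(4) sol2(4) s)
        show "has_hderiv i (\<lambda>y. m y s) (d1 i x s) x"
          unfolding m_def d1_def by (intro has_hderiv_diff sol1(5) sol2(5) s)
        show "has_hderiv i (\<lambda>y. d1 i y s) (d2 i x s) x"
          unfolding d1_def d2_def by (intro has_hderiv_diff sol1(6) sol2(6) s)
        show "has_hderiv i (\<lambda>y. b y s $ i) (b1 i x s) x"
          unfolding b1_def by (intro has_hderiv_hderiv assms(7) s)
        show "norm (b x s) \<le> K" using Kb[OF s(2), of x] Ks by linarith
        show "\<bar>c x s\<bar> \<le> K" using Kc[OF s(2), of x] Ks by linarith
        show "\<bar>b1 i x s\<bar> \<le> K" using Kd[OF s(2), of i x] Ks(4)[of i] by linarith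
        show "mt x s = \<sigma> * (\<Sum>i\<in>UNIV. d2 i x s) - (\<Sum>i\<in>UNIV. b x s $ i * d1 i x s) - c x s * m x s"
          unfolding mt_def sol1(9)[OF s(1)] sol2(9)[OF s(1)] d1_def d2_def m_def sum_2
          by (simp add: algebra_simps)
      qed (use R assms Ks t init in auto)
      also have "\<dots> \<le> cutoff_error \<sigma> \<alpha> K / R * (M1 + M2)"
        using N error_nonneg R by (intro mult_left_mono) auto
      finally show "integral (cbox (- R *\<^sub>R 1) (R *\<^sub>R 1)) (\<lambda>x. soft_abs (m x t1) * weight (3 * \<alpha>) R (gauge3 x))
          \<le> cutoff_error \<sigma> \<alpha> K * (M1 + M2) / R"
        by simp
    qed
  qed
  have decay_rate: "0 < decay_rate \<sigma> \<alpha> K"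
    using assms Ks(1) unfolding decay_rate_def by (intro add_pos_nonneg) auto
  \<comment> \<open>The longest step that \<open>energy_estimate\<close> admits; it depends on
    \<sigma>, \<alpha> and \<open>K\<close> only, so finitely many steps cover [0,T].\<close>
  define \<delta> where "\<delta> = \<alpha> / decay_rate \<sigma> \<alpha> K"
  have \<delta>: "\<delta> > 0" "decay_rate \<sigma> \<alpha> K * \<delta> = \<alpha>"
    using decay_rate assms by (auto simp: \<delta>_def)
  have zero: "m x 0 = 0" for x
    using sol1(2) sol2(2) by (simp add: m_def)
  have steps: "\<forall>x. \<forall>t\<in>{0..T}. t \<le> real n * \<delta> \<longrightarrow> m x t = 0" for n
  proof (induction n)
    case 0
    then show ?case using zero by auto
  next
    case (Suc n)
    show ?case
    proof (intro allI ballI impI)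
      fix x t assume t: "t \<in> {0..T}" "t \<le> real (Suc n) * \<delta>"
      show "m x t = 0"
      proof (cases "t \<le> real n * \<delta>")
        case True
        then show ?thesis using Suc t by auto
      next
        case False
        show ?thesis
        \<comment> \<open>The last step ends at \<open>t\<close> itself and may be shorter than
          \<delta>, so every time in the interval is reached and not only the multiples of
          \<delta>.\<close>
        proof (rule step[of "real n * \<delta>"])
          show "m y (real n * \<delta>) = 0" for y
            using Suc False t \<delta> by auto
          have "decay_rate \<sigma> \<alpha> K * (t - real n * \<delta>) \<le> decay_rate \<sigma> \<alpha> K * \<delta>"
            using t decay_rate by (intro mult_left_mono) (auto simp: algebra_simps)
          then show "decay_rate \<sigma> \<alpha> K * (t - real n * \<delta>) \<le> \<alpha>"
            unfolding \<delta>(2) .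
        qed (use False t \<delta> in auto)
      qed
    qed
  qed
  show ?thesis
  proof (intro allI ballI)
    fix x t assume t: "t \<in> {0..T}"
    obtain n where "T / \<delta> < real n"
      using reals_Archimedean2 by blast
    then have "t \<le> real n * \<delta>"
      using t \<delta>(1) by (simp add: field_simps)
    then show "m\<^sub>1 x t = m\<^sub>2 x t"
      using steps[of n] t by (auto simp: m_def)
  qed
qed

end
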